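(* Let $\Bbbk\in\{\mathbb{R},\mathbb{C},\mathbb{H},\mathbb{O}\}$ be a real Hurwitz algebra, with $n=3$ if $\Bbbk=\mathbb{O}$. Equip the Jordan algebra $(\mathrm{Herm}(n,\Bbbk),\star)$ with the metric $\hat h(x,y) = N^{-1}\operatorname{tr}L_\star(x\star y) = n^{-1}\operatorname{tr}(x\star y)$, where $N=\dim\mathrm{Herm}(n,\Bbbk)$ and $n$ is the rank of $\mathrm{Herm}(n,\Bbbk)$. For all linearly independent $x,y\in\mathrm{Herm}(n,\Bbbk)$, the sectional nonassociativity of $(\mathrm{Herm}(n,\Bbbk),\star,\hat h)$ satisfies $$0\leq \mathscr{K}(x,y)\leq \tfrac{n}{2}.$$ (1) If $\Bbbk$ is associative, equality holds in the lower bound if and only if $x$ and $y$ commute with respect to the matrix product; in particular, if $x$ and $x\star x$ are linearly independent, then $\mathscr{K}(x,x\star x)=0$. (2) Equality holds in the upper bound if and only if $x$ and $y$ are simultaneously equivalent under $\operatorname{Aut}(\mathrm{Herm}(n,\Bbbk),\star)$ to scalar multiples of $e_{11}-e_{nn}$ and $e_{1n}+e_{n1}$.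
   Context: $\mathrm{Herm}(n,\Bbbk)$ is the real vector space of $n\times n$ matrices $x$ over $\Bbbk$ with $\bar x^t=x$, where $\bar{\ }$ is the standard conjugation of $\Bbbk$ (trivial for $\mathbb{R}$). The product is $x\star y=\tfrac12(xy+yx)$, with juxtaposition the matrix product, and $L_\star(x)y=x\star y$. $e_{ij}$ is the elementary matrix with $1$ in position $(i,j)$ and $0$ elsewhere. $\operatorname{Aut}(\mathrm{Herm}(n,\Bbbk),\star)$ is the group of real-linear algebra automorphisms. For linearly independent $x,y$, $$\mathscr{K}(x,y)=\frac{\hat h(x\star x,y\star y)-\hat h(x\star y,x\star y)}{\hat h(x,x)\hat h(y,y)-\hat h(x,y)^2},$$ which depends only on $\operatorname{Span}\{x,y\}$.
   Formalization: In (2) the "only if" fails for non-orthogonal x, y (e.g. x=A, y=A+B with A=e_11-e_nn, B=e_1n+e_n1); it is proved when ĥ(x,y)=0, and for all independent x, y as: equality iff some automorphism maps Span{x,y} onto Span{A,B}. The "if" half is unrestricted. *)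

theory Defs
  imports "HOL-Analysis.Analysis"
begin

text \<open>
  The quaternions and octonions are obtained from the library's complex numbers by two
  Cayley-Dickson doublings, with the convention
  \<open>(a,b)(c,d) = (ac - d\<^sup>*b, da + bc\<^sup>*)\<close> and \<open>(a,b)\<^sup>* = (a\<^sup>*, -b)\<close>.
  Type synonyms for product types are used so that the real Euclidean space structure
  (addition, scaling, inner product) is the one of the library.
\<close>

type_synonym quaternion = "complex \<times> complex"
type_synonym octonion = "quaternion \<times> quaternion"

definition qcnj :: "quaternion \<Rightarrow> quaternion"
  where "qcnj p = (cnj (fst p), - snd p)"

definition qmul :: "quaternion \<Rightarrow> quaternion \<Rightarrow> quaternion"
  where "qmul p q = (fst p * fst q - cnj (snd q) * snd p, snd q * fst p + snd p * cnj (fst q))"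

definition ocnj :: "octonion \<Rightarrow> octonion"
  where "ocnj p = (qcnj (fst p), - snd p)"

definition omul :: "octonion \<Rightarrow> octonion \<Rightarrow> octonion"  (infixl "\<otimes>\<^sub>O" 70)
  where "p \<otimes>\<^sub>O q =
    (qmul (fst p) (fst q) - qmul (qcnj (snd q)) (snd p),
     qmul (snd q) (fst p) + qmul (snd p) (qcnj (fst q)))"

definition oct_of_quat :: "quaternion \<Rightarrow> octonion"
  where "oct_of_quat q = (q, 0)"

definition oct_of_complex :: "complex \<Rightarrow> octonion"
  where "oct_of_complex z = oct_of_quat (z, 0)"

definition oct_of_real :: "real \<Rightarrow> octonion"
  where "oct_of_real r = oct_of_complex (complex_of_real r)"

definition oRe :: "octonion \<Rightarrow> real"
  where "oRe p = Re (fst (fst p))"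

lemmas oct_defs = qcnj_def qmul_def ocnj_def omul_def
  oct_of_quat_def oct_of_complex_def oct_of_real_def oRe_def

text \<open>
  The four real Hurwitz algebras, as the nested subalgebras
  \<open>\<real> \<subset> \<complex> \<subset> \<H> \<subset> \<O>\<close> of the octonions. The lemmas below record that the embeddings respect
  product and conjugation and that the octonions form a composition algebra.
\<close>

definition Hurw_R :: "octonion set" where "Hurw_R = range oct_of_real"
definition Hurw_C :: "octonion set" where "Hurw_C = range oct_of_complex"
definition Hurw_H :: "octonion set" where "Hurw_H = range oct_of_quat"
definition Hurw_O :: "octonion set" where "Hurw_O = UNIV"

lemma oct_of_quat_hom:
  "oct_of_quat p \<otimes>\<^sub>O oct_of_quat q = oct_of_quat (qmul p q)"
  "ocnj (oct_of_quat p) = oct_of_quat (qcnj p)"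
  by (simp_all add: oct_defs zero_prod_def)

lemma oct_of_complex_hom:
  "oct_of_complex z \<otimes>\<^sub>O oct_of_complex w = oct_of_complex (z * w)"
  "ocnj (oct_of_complex z) = oct_of_complex (cnj z)"
  by (simp_all add: oct_defs zero_prod_def)

lemma oct_of_real_hom:
  "oct_of_real r \<otimes>\<^sub>O oct_of_real s = oct_of_real (r * s)"
  "ocnj (oct_of_real r) = oct_of_real r"
  by (simp_all add: oct_defs zero_prod_def)

lemma oct_unit: "oct_of_real 1 \<otimes>\<^sub>O p = p" "p \<otimes>\<^sub>O oct_of_real 1 = p"
  by (simp_all add: oct_defs zero_prod_def prod_eq_iff)

lemma oct_mult_cnj: "p \<otimes>\<^sub>O ocnj p = oct_of_real ((norm p)\<^sup>2)"
  by (simp add: oct_defs zero_prod_def prod_eq_iff complex_eq_iff norm_prod_def cmod_def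
      power2_eq_square algebra_simps)

lemma norm_omul: "norm (p \<otimes>\<^sub>O q) = norm p * norm q"
proof -
  have "(norm (p \<otimes>\<^sub>O q))\<^sup>2 = (norm p * norm q)\<^sup>2"
    by (simp add: power_mult_distrib norm_prod_def cmod_def oct_defs)
      (simp add: power2_eq_square algebra_simps)
  then show ?thesis by (simp add: power2_eq_iff_nonneg)
qed

definition assoc_on :: "octonion set \<Rightarrow> bool"
  where "assoc_on K \<longleftrightarrow> (\<forall>a\<in>K. \<forall>b\<in>K. \<forall>c\<in>K. (a \<otimes>\<^sub>O b) \<otimes>\<^sub>O c = a \<otimes>\<^sub>O (b \<otimes>\<^sub>O c))"

text \<open>
  The library's matrix product requires an associative ring of entries and is therefore not
  available over the octonions.
\<close>

definition mmul :: "octonion^'n^'n \<Rightarrow> octonion^'n^'n \<Rightarrow> octonion^'n^'n"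
  where "mmul x y = (\<chi> i j. \<Sum>l\<in>UNIV. x $ i $ l \<otimes>\<^sub>O y $ l $ j)"

definition jordan :: "octonion^'n^'n \<Rightarrow> octonion^'n^'n \<Rightarrow> octonion^'n^'n"  (infixl "\<star>" 70)
  where "x \<star> y = (1/2) *\<^sub>R (mmul x y + mmul y x)"

definition elem_mat :: "'n \<Rightarrow> 'n \<Rightarrow> octonion^'n^'n"
  where "elem_mat i j = (\<chi> a b. if a = i \<and> b = j then oct_of_real 1 else 0)"

definition Herm :: "octonion set \<Rightarrow> (octonion^'n^'n) set"
  where "Herm K = {x. \<forall>i j. x $ i $ j \<in> K \<and> ocnj (x $ j $ i) = x $ i $ j}"

text \<open>The diagonal entries of a Hermitian matrix are real, so \<open>oRe\<close> discards nothing there.\<close>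

definition mat_trace :: "octonion^'n^'n \<Rightarrow> real"
  where "mat_trace x = oRe (\<Sum>i\<in>UNIV. x $ i $ i)"

text \<open>
  Trace of a linear endomorphism \<open>f\<close> of a finite-dimensional subspace \<open>V\<close>: the sum of the diagonal
  coefficients with respect to any basis of \<open>V\<close>; the choice is immaterial.
\<close>

definition endo_trace :: "'a::real_vector set \<Rightarrow> ('a \<Rightarrow> 'a) \<Rightarrow> real"
  where "endo_trace V f =
    (let B = (SOME B. independent B \<and> span B = V) in \<Sum>b\<in>B. representation B (f b) b)"

definition hhat :: "octonion set \<Rightarrow> octonion^'n^'n \<Rightarrow> octonion^'n^'n \<Rightarrow> real"
  where "hhat K x y =
    endo_trace (Herm K :: (octonion^'n^'n) set) (\<lambda>z. (x \<star> y) \<star> z)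
      / real (dim (Herm K :: (octonion^'n^'n) set))"

definition sect_nonassoc :: "octonion set \<Rightarrow> octonion^'n^'n \<Rightarrow> octonion^'n^'n \<Rightarrow> real"
  where "sect_nonassoc K x y =
    (hhat K (x \<star> x) (y \<star> y) - hhat K (x \<star> y) (x \<star> y))
      / (hhat K x x * hhat K y y - (hhat K x y)\<^sup>2)"

text \<open>The condition \<open>x \<noteq> y\<close> is needed because \<open>{x, x}\<close> is a one-element set.\<close>

definition lin_indep :: "'a::real_vector \<Rightarrow> 'a \<Rightarrow> bool"
  where "lin_indep x y \<longleftrightarrow> x \<noteq> y \<and> independent {x, y}"

text \<open>Automorphisms are only constrained on \<open>Herm K\<close>; their values elsewhere are irrelevant.\<close>

definition Aut_Herm :: "octonion set \<Rightarrow> (octonion^'n^'n \<Rightarrow> octonion^'n^'n) set"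
  where "Aut_Herm K = {f. bij_betw f (Herm K) (Herm K)
    \<and> (\<forall>x\<in>Herm K. \<forall>y\<in>Herm K. f (x + y) = f x + f y)
    \<and> (\<forall>c. \<forall>x\<in>Herm K. f (c *\<^sub>R x) = c *\<^sub>R f x)
    \<and> (\<forall>x\<in>Herm K. \<forall>y\<in>Herm K. f (x \<star> y) = f x \<star> f y)}"

text \<open>
  The two matrices \<open>e\<^sub>1\<^sub>1 - e\<^sub>n\<^sub>n\<close> and \<open>e\<^sub>1\<^sub>n + e\<^sub>n\<^sub>1\<close>; the rows and columns are indexed by a finite
  linearly ordered type, whose least and greatest elements play the role of \<open>1\<close> and \<open>n\<close>.
\<close>

definition diag_1n :: "octonion^('n::{finite,linorder})^('n::{finite,linorder})"
  where "diag_1n = elem_mat (Min UNIV) (Min UNIV) - elem_mat (Max UNIV) (Max UNIV)"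

definition offdiag_1n :: "octonion^('n::{finite,linorder})^('n::{finite,linorder})"
  where "offdiag_1n = elem_mat (Min UNIV) (Max UNIV) + elem_mat (Max UNIV) (Min UNIV)"

definition simult_equiv_std :: "octonion set \<Rightarrow> octonion^('n::{finite,linorder})^('n::{finite,linorder}) \<Rightarrow>
    octonion^('n::{finite,linorder})^('n::{finite,linorder}) \<Rightarrow> bool"
  where "simult_equiv_std K x y \<longleftrightarrow>
    (\<exists>f\<in>Aut_Herm K. \<exists>a b. f x = a *\<^sub>R diag_1n \<and> f y = b *\<^sub>R offdiag_1n)"

end

theory Submission
  imports Defs
begin

text \<open>
For Hermitian \<open>x\<close> and \<open>y\<close> the form \<open>tr (x \<star> y)\<close> is the Euclidean inner product of the matrix entries,
and \<open>hhat\<close> is \<open>1/n\<close> times it: the trace of \<open>z \<mapsto> x \<star> z\<close> can be read off the frame of elementary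
Hermitian matrices, where an off-diagonal frame vector at \<open>(i, j)\<close> has eigenvalue
\<open>(x\<^sub>i\<^sub>i + x\<^sub>j\<^sub>j) / 2\<close> up to terms that do not contribute (lemmas \<open>endo_trace_frame\<close> and
\<open>endo_trace_jordan\<close>). So the nonassociativity is \<open>n\<close> times the quotient of
\<open>\<langle>x \<star> x, y \<star> y\<rangle> - \<langle>x \<star> y, x \<star> y\<rangle>\<close> by the Gram determinant of \<open>x\<close> and \<open>y\<close>.

The heart of the matter is that every \<open>x\<close> can be diagonalized by an automorphism that preserves the
inner product (\<open>diagonalization\<close>). These automorphisms form a compact set, so one of them maximizes the
sum of squares of the diagonal entries of the image of \<open>x\<close>. If an off-diagonal entry of that image
were nonzero, then a first automorphism would make the entry real without changing the diagonal, and
conjugation with a real reflection in the two coordinates would then enlarge the diagonal. Making an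
entry real is conjugation with a diagonal matrix when the entries associate; for \<open>3 \<times> 3\<close> octonion
matrices it is a triality map that multiplies the three off-diagonal entries by a unit \<open>u\<close> from the
left, from the right, and from both sides. The three Moufang identities say exactly that this map is an
automorphism.

With \<open>x\<close> diagonal of eigenvalues \<open>\<lambda>\<^sub>i\<close>, the numerator is
\<open>\<Sum>\<^sub>i\<^sub>j (\<lambda>\<^sub>i - \<lambda>\<^sub>j)\<^sup>2 \<bar>y\<^sub>i\<^sub>j\<bar>\<^sup>2 / 4\<close>, which is nonnegative. Since
\<open>(\<lambda>\<^sub>i - \<lambda>\<^sub>j)\<^sup>2 \<le> 2 (\<lambda>\<^sub>i\<^sup>2 + \<lambda>\<^sub>j\<^sup>2) \<le> 2 \<parallel>x\<parallel>\<^sup>2\<close>, twice the numerator is at most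
\<open>\<parallel>x\<parallel>\<^sup>2\<close> times the squared norm of the off-diagonal part of \<open>y\<close>, and by Cauchy-Schwarz on the
diagonals this is at most the Gram determinant. In case of equality only two eigenvalues are nonzero,
they are opposite, \<open>y\<close> lives off the diagonal only at the corresponding two positions, and its diagonal
is a multiple of \<open>x\<close> (\<open>extremal\<close>); making the surviving entry real and permuting coordinates yields the
standard plane (\<open>extremal_standard_form\<close>). Conversely any automorphism preserves \<open>hhat\<close>, because the trace
of an endomorphism is invariant under conjugation (\<open>hhat_Aut\<close>), so it suffices to compute in the standard
plane.

If the entries associate, cyclicity of the trace turns the numerator into a quarter of the squared
norm of the commutator \<open>xy - yx\<close> (\<open>nonassoc_num_commutator\<close>), which gives the case of equality in the
lower bound.
\<close>

section \<open>Octonion identities\<close>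

lemma bilinear_omul: "bilinear (\<otimes>\<^sub>O)"
  by (intro bilinear_def[THEN iffD2] conjI allI linearI)
     (simp_all add: oct_defs prod_eq_iff complex_eq_iff algebra_simps)

interpretation omul: bounded_bilinear "(\<otimes>\<^sub>O)"
  using bilinear_omul by (simp add: bilinear_conv_bounded_bilinear)

declare omul.zero_left [simp] omul.zero_right [simp]

lemma linear_ocnj: "linear ocnj"
  by (intro linearI) (simp_all add: oct_defs prod_eq_iff complex_eq_iff)

lemma ocnj_ocnj [simp]: "ocnj (ocnj a) = a"
  by (simp add: oct_defs prod_eq_iff)

lemma ocnj_omul: "ocnj (a \<otimes>\<^sub>O b) = ocnj b \<otimes>\<^sub>O ocnj a"
  by (simp add: oct_defs prod_eq_iff complex_eq_iff algebra_simps)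

lemma norm_ocnj [simp]: "norm (ocnj a) = norm a"
  by (simp add: oct_defs norm_prod_def cmod_def)

lemma oct_of_real_scaleR: "oct_of_real r = r *\<^sub>R oct_of_real 1"
  by (simp add: oct_defs prod_eq_iff complex_eq_iff zero_prod_def)

lemma omul_oct_of_real [simp]:
  "oct_of_real r \<otimes>\<^sub>O a = r *\<^sub>R a" "a \<otimes>\<^sub>O oct_of_real r = r *\<^sub>R a"
  by (simp_all add: oct_defs prod_eq_iff complex_eq_iff zero_prod_def)

lemma oRe_inner: "oRe a = a \<bullet> oct_of_real 1"
  by (simp add: oct_defs inner_prod_def inner_complex_def zero_prod_def)

lemma oRe_omul: "oRe (a \<otimes>\<^sub>O b) = a \<bullet> ocnj b"
  by (simp add: oct_defs inner_prod_def inner_complex_def)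

lemma inner_omul_left: "(a \<otimes>\<^sub>O b) \<bullet> c = b \<bullet> (ocnj a \<otimes>\<^sub>O c)"
  by (simp add: oct_defs inner_prod_def inner_complex_def algebra_simps)

lemma inner_omul_right: "(a \<otimes>\<^sub>O b) \<bullet> c = a \<bullet> (c \<otimes>\<^sub>O ocnj b)"
  by (simp add: oct_defs inner_prod_def inner_complex_def algebra_simps)

lemma ocnj_eq: "ocnj a = (2 * oRe a) *\<^sub>R oct_of_real 1 - a"
  by (simp add: oct_defs prod_eq_iff complex_eq_iff zero_prod_def)

lemma ocnj_fixed: "ocnj a = a \<Longrightarrow> a = oct_of_real (oRe a)"
  by (simp add: oct_defs prod_eq_iff complex_eq_iff zero_prod_def)

lemma oRe_oct_of_real [simp]: "oRe (oct_of_real r) = r"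
  by (simp add: oct_defs)

lemma norm_oct_of_real [simp]: "norm (oct_of_real r) = \<bar>r\<bar>"
  by (simp add: oct_defs zero_prod_def norm_prod_def)

lemma omul_polar: "a \<otimes>\<^sub>O ocnj b + b \<otimes>\<^sub>O ocnj a = oct_of_real (2 * (a \<bullet> b))"
  by (simp add: oct_defs prod_eq_iff complex_eq_iff zero_prod_def inner_prod_def inner_complex_def algebra_simps)

text \<open>
This is the multiplicativity of the norm, polarized in both arguments. Together with the two adjunction
rules above it implies the alternative and Moufang laws without any expansion into coordinates.
\<close>
lemma omul_inner_exchange:
  "(a \<otimes>\<^sub>O b) \<bullet> (c \<otimes>\<^sub>O d) + (c \<otimes>\<^sub>O b) \<bullet> (a \<otimes>\<^sub>O d) = 2 * (a \<bullet> c) * (b \<bullet> d)"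
proof -
  have *: "(p \<otimes>\<^sub>O b) \<bullet> (p \<otimes>\<^sub>O d) = (p \<bullet> p) * (b \<bullet> d)" for p
  proof -
    have "(norm (p \<otimes>\<^sub>O (b + d)))\<^sup>2 = (norm p)\<^sup>2 * (norm (b + d))\<^sup>2"
      "(norm (p \<otimes>\<^sub>O b))\<^sup>2 = (norm p)\<^sup>2 * (norm b)\<^sup>2"
      "(norm (p \<otimes>\<^sub>O d))\<^sup>2 = (norm p)\<^sup>2 * (norm d)\<^sup>2"
      by (simp_all add: norm_omul power_mult_distrib)
    then show ?thesis
      by (simp add: power2_norm_eq_inner omul.add_right inner_add inner_commute algebra_simps)
  qed
  have "((a + c) \<otimes>\<^sub>O b) \<bullet> ((a + c) \<otimes>\<^sub>O d) = ((a + c) \<bullet> (a + c)) * (b \<bullet> d)"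
    by (rule *)
  then show ?thesis
    using *[of a] *[of c] by (simp add: omul.add_left inner_add inner_commute algebra_simps)
qed

lemma omul_cancel_left: "ocnj u \<otimes>\<^sub>O (u \<otimes>\<^sub>O a) = (norm u)\<^sup>2 *\<^sub>R a"
proof (rule vector_eq_ldot[THEN iffD1], rule allI)
  fix t
  show "t \<bullet> (ocnj u \<otimes>\<^sub>O (u \<otimes>\<^sub>O a)) = t \<bullet> ((norm u)\<^sup>2 *\<^sub>R a)"
    using omul_inner_exchange[of u a u t] inner_omul_left[of u t "u \<otimes>\<^sub>O a"]
    by (simp add: power2_norm_eq_inner inner_commute)
qed

text \<open>
For a unit \<open>u\<close>, the map \<open>c \<mapsto> u c u\<close> sends the conjugate of \<open>u\<close> to \<open>u\<close> and is minus conjugation on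
the orthogonal complement. Expressing it by conjugation and inner products makes
it possible to compare it with other products by testing against a vector.
\<close>
lemma omul_sandwich: "(u \<otimes>\<^sub>O c) \<otimes>\<^sub>O u = (2 * (u \<bullet> ocnj c)) *\<^sub>R u - (norm u)\<^sup>2 *\<^sub>R ocnj c"
proof (rule vector_eq_ldot[THEN iffD1], rule allI)
  fix t
  have "t \<bullet> ((u \<otimes>\<^sub>O c) \<otimes>\<^sub>O u) = (u \<otimes>\<^sub>O c) \<bullet> (t \<otimes>\<^sub>O ocnj u)"
    by (metis inner_omul_right inner_commute)
  also have "\<dots> = 2 * (u \<bullet> t) * (c \<bullet> ocnj u) - (t \<otimes>\<^sub>O c) \<bullet> (u \<otimes>\<^sub>O ocnj u)"
    using omul_inner_exchange[of u c t "ocnj u"] by simp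
  also have "(t \<otimes>\<^sub>O c) \<bullet> (u \<otimes>\<^sub>O ocnj u) = (norm u)\<^sup>2 * (t \<bullet> ocnj c)"
    by (simp add: oct_mult_cnj inner_omul_right)
  also have "c \<bullet> ocnj u = u \<bullet> ocnj c"
    by (simp add: oct_defs inner_prod_def inner_complex_def)
  finally show "t \<bullet> ((u \<otimes>\<^sub>O c) \<otimes>\<^sub>O u) = t \<bullet> ((2 * (u \<bullet> ocnj c)) *\<^sub>R u - (norm u)\<^sup>2 *\<^sub>R ocnj c)"
    by (simp add: inner_diff_right inner_commute)
qed

text \<open>
Pairing the left-hand side with \<open>t\<close> and moving \<open>b u\<close> to the other side turns it into a product of the
form handled by \<open>omul_inner_exchange\<close>; the two resulting terms are those of \<open>omul_sandwich\<close>.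
\<close>
lemma moufang_middle: "(u \<otimes>\<^sub>O a) \<otimes>\<^sub>O (b \<otimes>\<^sub>O u) = (u \<otimes>\<^sub>O (a \<otimes>\<^sub>O b)) \<otimes>\<^sub>O u"
proof (rule vector_eq_ldot[THEN iffD1], rule allI)
  fix t
  have "t \<bullet> ((u \<otimes>\<^sub>O a) \<otimes>\<^sub>O (b \<otimes>\<^sub>O u)) = (u \<otimes>\<^sub>O a) \<bullet> (t \<otimes>\<^sub>O (ocnj u \<otimes>\<^sub>O ocnj b))"
    by (metis inner_omul_right inner_commute ocnj_omul)
  also have "\<dots> = 2 * (u \<bullet> t) * (a \<bullet> (ocnj u \<otimes>\<^sub>O ocnj b)) - (t \<otimes>\<^sub>O a) \<bullet> (u \<otimes>\<^sub>O (ocnj u \<otimes>\<^sub>O ocnj b))"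
    using omul_inner_exchange[of u a t "ocnj u \<otimes>\<^sub>O ocnj b"] by simp
  also have "u \<otimes>\<^sub>O (ocnj u \<otimes>\<^sub>O ocnj b) = (norm u)\<^sup>2 *\<^sub>R ocnj b"
    using omul_cancel_left[of "ocnj u" "ocnj b"] by simp
  also have "(t \<otimes>\<^sub>O a) \<bullet> ((norm u)\<^sup>2 *\<^sub>R ocnj b) = (norm u)\<^sup>2 * (t \<bullet> ocnj (a \<otimes>\<^sub>O b))"
    by (simp add: inner_omul_right ocnj_omul)
  also have "a \<bullet> (ocnj u \<otimes>\<^sub>O ocnj b) = u \<bullet> ocnj (a \<otimes>\<^sub>O b)"
    by (metis inner_omul_right inner_omul_left inner_commute ocnj_omul ocnj_ocnj)
  finally show "t \<bullet> ((u \<otimes>\<^sub>O a) \<otimes>\<^sub>O (b \<otimes>\<^sub>O u)) = t \<bullet> ((u \<otimes>\<^sub>O (a \<otimes>\<^sub>O b)) \<otimes>\<^sub>O u)"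
    by (simp add: omul_sandwich inner_diff_right inner_commute)
qed

lemma moufang_left: "((u \<otimes>\<^sub>O c) \<otimes>\<^sub>O u) \<otimes>\<^sub>O d = u \<otimes>\<^sub>O (c \<otimes>\<^sub>O (u \<otimes>\<^sub>O d))"
proof (rule vector_eq_ldot[THEN iffD1], rule allI)
  fix t
  have "t \<bullet> (u \<otimes>\<^sub>O (c \<otimes>\<^sub>O (u \<otimes>\<^sub>O d))) = (c \<otimes>\<^sub>O (u \<otimes>\<^sub>O d)) \<bullet> (ocnj u \<otimes>\<^sub>O t)"
    by (metis inner_omul_left inner_commute)
  also have "\<dots> = 2 * (c \<bullet> ocnj u) * ((u \<otimes>\<^sub>O d) \<bullet> t) - (ocnj u \<otimes>\<^sub>O (u \<otimes>\<^sub>O d)) \<bullet> (c \<otimes>\<^sub>O t)"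
    using omul_inner_exchange[of c "u \<otimes>\<^sub>O d" "ocnj u" t] by simp
  also have "\<dots> = 2 * (c \<bullet> ocnj u) * ((u \<otimes>\<^sub>O d) \<bullet> t) - (norm u)\<^sup>2 * (t \<bullet> (ocnj c \<otimes>\<^sub>O d))"
    by (simp add: omul_cancel_left) (metis inner_omul_left inner_commute)
  also have "c \<bullet> ocnj u = u \<bullet> ocnj c"
    by (simp add: oct_defs inner_prod_def inner_complex_def)
  finally show "t \<bullet> (((u \<otimes>\<^sub>O c) \<otimes>\<^sub>O u) \<otimes>\<^sub>O d) = t \<bullet> (u \<otimes>\<^sub>O (c \<otimes>\<^sub>O (u \<otimes>\<^sub>O d)))"
    by (simp add: omul_sandwich omul.diff_left omul.scaleR_left inner_diff_right inner_commute)
qed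

lemma moufang_right: "d \<otimes>\<^sub>O ((u \<otimes>\<^sub>O c) \<otimes>\<^sub>O u) = ((d \<otimes>\<^sub>O u) \<otimes>\<^sub>O c) \<otimes>\<^sub>O u"
proof -
  have "ocnj (d \<otimes>\<^sub>O ((u \<otimes>\<^sub>O c) \<otimes>\<^sub>O u)) = ocnj (((d \<otimes>\<^sub>O u) \<otimes>\<^sub>O c) \<otimes>\<^sub>O u)"
    using moufang_left[of "ocnj u" "ocnj c" "ocnj d"] moufang_left[of "ocnj u" "ocnj c" "oct_of_real 1"]
    by (simp add: ocnj_omul)
  then show ?thesis by (metis ocnj_ocnj)
qed

section \<open>Traces of endomorphisms\<close>

text \<open>
The trace may be computed with any family that reproduces the vectors of \<open>V\<close> (a frame together with
dual functionals), not only with a basis: expand the basis vectors chosen in the definition in the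
frame, exchange the two sums, and recombine. The freedom to use a redundant frame avoids choosing one
of the positions \<open>(i, j)\<close>, \<open>(j, i)\<close> for a Hermitian matrix. The maps need to be linear on \<open>V\<close> only, as is
the case for automorphisms of Hermitian matrices.
\<close>
lemma endo_trace_frame:
  fixes V :: "'a::euclidean_space set" and v :: "'i \<Rightarrow> 'a" and \<alpha> :: "'i \<Rightarrow> 'a \<Rightarrow> real"
  assumes V: "subspace V" and I: "finite I" and v: "\<And>i. i \<in> I \<Longrightarrow> v i \<in> V"
    and add: "\<And>i a b. \<lbrakk>i \<in> I; a \<in> V; b \<in> V\<rbrakk> \<Longrightarrow> \<alpha> i (a + b) = \<alpha> i a + \<alpha> i b"
    and scale: "\<And>i c a. \<lbrakk>i \<in> I; a \<in> V\<rbrakk> \<Longrightarrow> \<alpha> i (c *\<^sub>R a) = c * \<alpha> i a"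
    and frame: "\<And>w. w \<in> V \<Longrightarrow> w = (\<Sum>i\<in>I. \<alpha> i w *\<^sub>R v i)"
    and fV: "\<And>a. a \<in> V \<Longrightarrow> f a \<in> V"
    and fadd: "\<And>a b. \<lbrakk>a \<in> V; b \<in> V\<rbrakk> \<Longrightarrow> f (a + b) = f a + f b"
    and fscale: "\<And>c a. a \<in> V \<Longrightarrow> f (c *\<^sub>R a) = c *\<^sub>R f a"
  shows "endo_trace V f = (\<Sum>i\<in>I. \<alpha> i (f (v i)))"
proof -
  \<comment> \<open>a sum over a possibly redundant family, so the vectors need not be distinct\<close>
  have sum_on: "g (\<Sum>j\<in>J. c j *\<^sub>R u j) = (\<Sum>j\<in>J. c j *\<^sub>R g (u j))"
    if "finite J" "\<And>j. j \<in> J \<Longrightarrow> u j \<in> V"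
      and g: "\<And>a b. \<lbrakk>a \<in> V; b \<in> V\<rbrakk> \<Longrightarrow> g (a + b) = g a + g b" "\<And>c a. a \<in> V \<Longrightarrow> g (c *\<^sub>R a) = c *\<^sub>R g a"
    for g :: "'a \<Rightarrow> 'b::real_vector" and J :: "'j set" and c u
    using that(1,2)
  proof (induction J rule: finite_induct)
    case empty
    show ?case using g(2)[of 0 0] subspace_0[OF V] by simp
  next
    case (insert j J)
    have "(\<Sum>j\<in>J. c j *\<^sub>R u j) \<in> V" "c j *\<^sub>R u j \<in> V" "u j \<in> V"
      using insert by (auto intro!: subspace_sum subspace_scale V)
    then show ?case using insert by (simp add: g)
  qed
  define B where "B = (SOME B. independent B \<and> span B = V)"
  have "\<exists>B. independent B \<and> span B = V"
    by (metis V basis_exists span_eq_iff span_mono span_span subset_antisym)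
  then have B: "independent B" "span B = V"
    unfolding B_def by (metis (mono_tags, lifting) someI_ex)+
  then have "finite B" and BV: "\<And>b. b \<in> B \<Longrightarrow> b \<in> V"
    using independent_imp_finite span_base by auto
  let ?r = "representation B"
  have r_add: "?r (a + b) c = ?r a c + ?r b c" and r_scale: "?r (t *\<^sub>R a) c = t *\<^sub>R ?r a c"
    if "a \<in> V" "b \<in> V" for a b c t
    using that B by (simp_all add: representation_add representation_scale)
  have "endo_trace V f = (\<Sum>b\<in>B. ?r (f b) b)"
    by (simp add: endo_trace_def B_def Let_def)
  also have "\<dots> = (\<Sum>b\<in>B. \<Sum>i\<in>I. \<alpha> i b * ?r (f (v i)) b)"
  proof (rule sum.cong[OF refl])
    fix b assume b: "b \<in> B"
    have "f b = f (\<Sum>i\<in>I. \<alpha> i b *\<^sub>R v i)"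
      using frame[OF BV[OF b]] by simp
    also have "\<dots> = (\<Sum>i\<in>I. \<alpha> i b *\<^sub>R f (v i))"
      by (rule sum_on) (auto simp: I v fadd fscale)
    finally show "?r (f b) b = (\<Sum>i\<in>I. \<alpha> i b * ?r (f (v i)) b)"
      using sum_on[OF I, of "\<lambda>i. f (v i)" "\<lambda>a. ?r a b" "\<lambda>i. \<alpha> i b"] r_add r_scale fV v by simp
  qed
  also have "\<dots> = (\<Sum>i\<in>I. \<Sum>b\<in>B. ?r (f (v i)) b * \<alpha> i b)"
    by (subst sum.swap) (simp add: mult.commute)
  also have "\<dots> = (\<Sum>i\<in>I. \<alpha> i (f (v i)))"
  proof (rule sum.cong[OF refl])
    fix i assume i: "i \<in> I"
    have "\<alpha> i (f (v i)) = \<alpha> i (\<Sum>b\<in>B. ?r (f (v i)) b *\<^sub>R b)"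
      using sum_representation_eq[of B "f (v i)" B] B fV[OF v[OF i]] \<open>finite B\<close> by simp
    also have "\<dots> = (\<Sum>b\<in>B. ?r (f (v i)) b *\<^sub>R \<alpha> i b)"
      by (rule sum_on) (auto simp: \<open>finite B\<close> BV add scale i)
    finally show "(\<Sum>b\<in>B. ?r (f (v i)) b * \<alpha> i b) = \<alpha> i (f (v i))" by simp
  qed
  finally show ?thesis .
qed

lemma endo_trace_basis:
  fixes V :: "'a::euclidean_space set"
  assumes "independent B" "span B = V"
    and "\<And>a. a \<in> V \<Longrightarrow> f a \<in> V" "\<And>a b. \<lbrakk>a \<in> V; b \<in> V\<rbrakk> \<Longrightarrow> f (a + b) = f a + f b"
    and "\<And>c a. a \<in> V \<Longrightarrow> f (c *\<^sub>R a) = c *\<^sub>R f a"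
  shows "endo_trace V f = (\<Sum>b\<in>B. representation B (f b) b)"
  using assms
  by (intro endo_trace_frame)
     (auto simp: independent_imp_finite span_base representation_add representation_scale sum_representation_eq)

lemma endo_trace_id:
  fixes V :: "'a::euclidean_space set"
  assumes "subspace V"
  shows "endo_trace V (\<lambda>a. a) = real (dim V)"
proof -
  obtain B where B: "independent B" "span B = V" "card B = dim V"
    by (metis assms basis_exists span_eq_iff span_mono subset_antisym)
  then show ?thesis
    by (subst endo_trace_basis[OF B(1,2)]) (simp_all add: representation_basis)
qed

text \<open>
The images of a basis under \<open>\<phi>\<close> are a frame whose dual functionals are the old coordinates of the
preimages, and in this frame \<open>g\<close> has the diagonal coefficients of \<open>f\<close>.
\<close>
lemma endo_trace_conj:
  fixes V :: "'a::euclidean_space set"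
  assumes V: "subspace V" and bij: "bij_betw \<phi> V V"
    and add: "\<And>a b. \<lbrakk>a \<in> V; b \<in> V\<rbrakk> \<Longrightarrow> \<phi> (a + b) = \<phi> a + \<phi> b"
    and scale: "\<And>c a. a \<in> V \<Longrightarrow> \<phi> (c *\<^sub>R a) = c *\<^sub>R \<phi> a"
    and f: "\<And>a. a \<in> V \<Longrightarrow> f a \<in> V" "\<And>a b. \<lbrakk>a \<in> V; b \<in> V\<rbrakk> \<Longrightarrow> f (a + b) = f a + f b"
      "\<And>c a. a \<in> V \<Longrightarrow> f (c *\<^sub>R a) = c *\<^sub>R f a"
    and g: "\<And>a. a \<in> V \<Longrightarrow> g a \<in> V" "\<And>a b. \<lbrakk>a \<in> V; b \<in> V\<rbrakk> \<Longrightarrow> g (a + b) = g a + g b"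
      "\<And>c a. a \<in> V \<Longrightarrow> g (c *\<^sub>R a) = c *\<^sub>R g a"
    and intertwine: "\<And>a. a \<in> V \<Longrightarrow> g (\<phi> a) = \<phi> (f a)"
  shows "endo_trace V g = endo_trace V f"
proof -
  obtain B where B: "independent B" "span B = V"
    by (metis V basis_exists span_eq_iff span_mono subset_antisym)
  then have fin: "finite B" and BV: "\<And>b. b \<in> B \<Longrightarrow> b \<in> V"
    using independent_imp_finite span_base by auto
  define \<psi> where "\<psi> = the_inv_into V \<phi>"
  have \<phi>V: "\<phi> a \<in> V" and \<psi>V: "\<psi> a \<in> V" and \<phi>\<psi>: "\<phi> (\<psi> a) = a" and \<psi>\<phi>: "\<psi> (\<phi> a) = a" if "a \<in> V" for a
    using bij that unfolding \<psi>_def bij_betw_def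
    by (auto simp: the_inv_into_f_f f_the_inv_into_f intro: the_inv_into_into)
  have \<psi>add: "\<psi> (a + b) = \<psi> a + \<psi> b" if "a \<in> V" "b \<in> V" for a b
    using \<psi>\<phi>[of "\<psi> a + \<psi> b"] that by (simp add: add \<psi>V \<phi>\<psi> V subspace_add)
  have \<psi>scale: "\<psi> (c *\<^sub>R a) = c *\<^sub>R \<psi> a" if "a \<in> V" for a c
    using \<psi>\<phi>[of "c *\<^sub>R \<psi> a"] that by (simp add: scale \<psi>V \<phi>\<psi> V subspace_scale)
  let ?r = "representation B"
  have "endo_trace V g = (\<Sum>b\<in>B. ?r (\<psi> (g (\<phi> b))) b)"
  proof (rule endo_trace_frame[where \<alpha> = "\<lambda>b a. ?r (\<psi> a) b"])
    fix w assume w: "w \<in> V"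
    have lin: "\<phi> (\<Sum>b\<in>C. c b *\<^sub>R b) = (\<Sum>b\<in>C. c b *\<^sub>R \<phi> b) \<and> (\<Sum>b\<in>C. c b *\<^sub>R b) \<in> V"
      if "finite C" "C \<subseteq> V" for C c
      using that
      by (induction C rule: finite_induct)
         (use scale[of 0 0] subspace_0[OF V] in \<open>auto simp: add scale V subspace_add subspace_scale\<close>)
    have "w = \<phi> (\<Sum>b\<in>B. ?r (\<psi> w) b *\<^sub>R b)"
      using sum_representation_eq[of B "\<psi> w" B] B fin \<psi>V[OF w] \<phi>\<psi>[OF w] by simp
    then show "w = (\<Sum>b\<in>B. ?r (\<psi> w) b *\<^sub>R \<phi> b)"
      using lin[OF fin, of "?r (\<psi> w)"] BV by (simp add: subset_iff)
  qed (use B in \<open>auto simp: V fin BV \<phi>V \<psi>V \<psi>add \<psi>scale g representation_add representation_scale\<close>)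
  also have "\<dots> = (\<Sum>b\<in>B. ?r (f b) b)"
    by (rule sum.cong) (auto simp: intertwine BV f \<psi>\<phi>)
  also have "\<dots> = endo_trace V f"
    using endo_trace_basis[OF B] f by simp
  finally show ?thesis .
qed

section \<open>The trace form on Hermitian matrices\<close>

lemma HermD:
  assumes "x \<in> Herm K"
  shows "x $ i $ j \<in> K" "ocnj (x $ i $ j) = x $ j $ i" "x $ i $ i = oct_of_real (oRe (x $ i $ i))"
    "norm (x $ j $ i) = norm (x $ i $ j)"
proof -
  show "x $ i $ j \<in> K" and c: "ocnj (x $ i $ j) = x $ j $ i" for i j
    using assms by (auto simp: Herm_def)
  then show "x $ i $ i = oct_of_real (oRe (x $ i $ i))"
    by (intro ocnj_fixed)
  show "norm (x $ j $ i) = norm (x $ i $ j)"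
    by (metis c norm_ocnj)
qed

lemma mmul_nth: "mmul x y $ i $ j = (\<Sum>l\<in>UNIV. x $ i $ l \<otimes>\<^sub>O y $ l $ j)"
  by (simp add: mmul_def)

lemma mmul_add: "mmul (x + x') y = mmul x y + mmul x' y" "mmul x (y + y') = mmul x y + mmul x y'"
  by (simp_all add: vec_eq_iff mmul_nth omul.add_left omul.add_right sum.distrib)

lemma mmul_scaleR: "mmul (c *\<^sub>R x) y = c *\<^sub>R mmul x y" "mmul x (c *\<^sub>R y) = c *\<^sub>R mmul x y"
  by (simp_all add: vec_eq_iff mmul_nth omul.scaleR_left omul.scaleR_right scaleR_sum_right)

lemma bilinear_jordan: "bilinear (\<star>)"
  by (intro bilinear_def[THEN iffD2] conjI allI linearI)
     (simp_all add: jordan_def mmul_add mmul_scaleR algebra_simps)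

interpretation jordan: bounded_bilinear "(\<star>)"
  using bilinear_jordan by (simp add: bilinear_conv_bounded_bilinear)

lemma jordan_commute: "x \<star> y = y \<star> x"
  by (simp add: jordan_def add.commute)

lemma jordan_nth:
  "(x \<star> y) $ i $ j = (1/2) *\<^sub>R (\<Sum>l\<in>UNIV. x $ i $ l \<otimes>\<^sub>O y $ l $ j + y $ i $ l \<otimes>\<^sub>O x $ l $ j)"
  by (simp add: jordan_def mmul_nth sum.distrib)

lemma mat_trace_eq: "mat_trace x = (\<Sum>i\<in>UNIV. oRe (x $ i $ i))"
  by (simp add: mat_trace_def oRe_inner inner_sum_left)

lemma mat_trace_mmul: "mat_trace (mmul x y) = (\<Sum>i\<in>UNIV. \<Sum>j\<in>UNIV. x $ i $ j \<bullet> ocnj (y $ j $ i))"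
proof -
  have "oRe (\<Sum>l\<in>UNIV. f l) = (\<Sum>l\<in>UNIV. oRe (f l))" for f :: "'a \<Rightarrow> octonion"
    by (simp add: oRe_inner inner_sum_left)
  then show ?thesis by (simp add: mat_trace_eq mmul_nth oRe_omul)
qed

lemma inner_ocnj_commute: "a \<bullet> ocnj b = b \<bullet> ocnj a"
  by (simp add: oct_defs inner_prod_def inner_complex_def algebra_simps)

lemma mat_trace_mmul_commute: "mat_trace (mmul x y) = mat_trace (mmul y x)"
  unfolding mat_trace_mmul
  by (subst sum.swap) (intro sum.cong refl inner_ocnj_commute)

lemma mat_trace_linear: "mat_trace (x + y) = mat_trace x + mat_trace y"
  "mat_trace (x - y) = mat_trace x - mat_trace y"
  "mat_trace (c *\<^sub>R x) = c * mat_trace x"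
  by (simp_all add: mat_trace_eq oRe_inner inner_add_left inner_diff_left sum.distrib sum_subtractf sum_distrib_left)

lemma mat_trace_jordan: "mat_trace (x \<star> y) = mat_trace (mmul x y)"
  by (simp add: jordan_def mat_trace_linear mat_trace_mmul_commute[of y x])

text \<open>
Conjugating the entries of \<open>y\<close> amounts to transposing it, so the trace form is the inner product of the
ambient Euclidean space.
\<close>
lemma mat_trace_jordan_Herm:
  assumes "y \<in> Herm K"
  shows "mat_trace (x \<star> y) = x \<bullet> y"
  by (simp add: mat_trace_jordan mat_trace_mmul inner_vec_def HermD(2)[OF assms])

text \<open>
The Hermitian parts of the matrices with a single entry \<open>u\<close> at \<open>(i, j)\<close>. When \<open>u\<close> runs through an
orthonormal basis of the entry algebra, a Hermitian \<open>w\<close> is the sum of these matrices with the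
coefficients \<open>\<langle>w\<^sub>i\<^sub>j, u\<rangle>\<close>.
\<close>
definition herm_frame :: "'n \<Rightarrow> 'n \<Rightarrow> octonion \<Rightarrow> octonion^'n^'n"
  where "herm_frame i j u =
    (\<chi> a b. (1/2) *\<^sub>R ((if a = i \<and> b = j then u else 0) + (if a = j \<and> b = i then ocnj u else 0)))"

text \<open>
All four algebras are treated together as unital subalgebras of the octonions. Closure under
conjugation follows, since the conjugate of \<open>a\<close> is a real multiple of the unit minus \<open>a\<close>.
\<close>
locale hurwitz_subalgebra =
  fixes K :: "octonion set"
  assumes subspace: "subspace K" and one: "oct_of_real 1 \<in> K"
    and mult: "\<And>a b. a \<in> K \<Longrightarrow> b \<in> K \<Longrightarrow> a \<otimes>\<^sub>O b \<in> K"
begin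

lemma cnj: "a \<in> K \<Longrightarrow> ocnj a \<in> K"
  unfolding ocnj_eq by (intro subspace_diff subspace_scale subspace one)

lemma subspace_Herm: "subspace (Herm K)"
  using subspace linear_ocnj
  by (auto simp: subspace_def Herm_def linear_0 linear_add linear_scale)

lemma jordan_Herm:
  assumes "x \<in> Herm K" "y \<in> Herm K"
  shows "x \<star> y \<in> Herm K"
proof -
  note xy = HermD[OF assms(1)] HermD[OF assms(2)]
  have "(x \<star> y) $ i $ j \<in> K" for i j
    unfolding jordan_nth
    by (intro subspace_scale subspace subspace_sum subspace_add mult xy)
  moreover have "ocnj ((x \<star> y) $ j $ i) = (x \<star> y) $ i $ j" for i j
    by (simp add: jordan_nth linear_scale[OF linear_ocnj] linear_sum[OF linear_ocnj]
        linear_add[OF linear_ocnj] ocnj_omul xy add.commute)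
  ultimately show ?thesis by (simp add: Herm_def)
qed

lemma Parseval_frame:
  "\<exists>U. finite U \<and> U \<subseteq> K \<and> (\<forall>u\<in>U. norm u = 1) \<and> (\<forall>w\<in>K. w = (\<Sum>u\<in>U. (w \<bullet> u) *\<^sub>R u))"
proof -
  obtain U where U: "U \<subseteq> K" "pairwise orthogonal U" "\<And>u. u \<in> U \<Longrightarrow> norm u = 1" "independent U" "span U = K"
    using orthonormal_basis_subspace[OF subspace] by metis
  have "w = (\<Sum>u\<in>U. (w \<bullet> u) *\<^sub>R u)" if w: "w \<in> K" for w
  proof -
    have fin: "finite U" using U(4) by (rule independent_imp_finite)
    obtain c where c: "w = (\<Sum>u\<in>U. c u *\<^sub>R u)"
      using w unfolding U(5)[symmetric] span_finite[OF fin] by blast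
    have "w \<bullet> u = c u" if "u \<in> U" for u
    proof -
      have "w \<bullet> u = (\<Sum>v\<in>U. if v = u then c u else 0)"
        unfolding c inner_sum_left
        by (rule sum.cong) (use U that in \<open>auto simp: pairwise_def orthogonal_def dot_square_norm\<close>)
      then show ?thesis using fin that by simp
    qed
    then show ?thesis using c by (metis (no_types, lifting) sum.cong)
  qed
  then show ?thesis
    using U independent_imp_finite[OF U(4)] by (intro exI[of _ U] conjI ballI) simp_all
qed

lemma endo_trace_Herm:
  fixes f :: "octonion^'n^'n \<Rightarrow> octonion^'n^'n"
  assumes U: "finite U" "U \<subseteq> K" "\<forall>w\<in>K. w = (\<Sum>u\<in>U. (w \<bullet> u) *\<^sub>R u)"
    and f: "linear f" "\<And>a. a \<in> Herm K \<Longrightarrow> f a \<in> Herm K"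
  shows "endo_trace (Herm K) f = (\<Sum>i\<in>UNIV. \<Sum>j\<in>UNIV. \<Sum>u\<in>U. f (herm_frame i j u) $ i $ j \<bullet> u)"
proof -
  have "endo_trace (Herm K) f =
      (\<Sum>(i, j, u)\<in>UNIV \<times> UNIV \<times> U. f (herm_frame i j u) $ i $ j \<bullet> u)"
    unfolding case_prod_unfold
  proof (rule endo_trace_frame[where v = "\<lambda>p. herm_frame (fst p) (fst (snd p)) (snd (snd p))"
        and \<alpha> = "\<lambda>p w. w $ fst p $ fst (snd p) \<bullet> snd (snd p)"])
    fix p :: "'n \<times> 'n \<times> octonion" assume "p \<in> UNIV \<times> UNIV \<times> U"
    then have u: "snd (snd p) \<in> K" using U by auto
    have c0: "ocnj 0 = 0" by (rule linear_0[OF linear_ocnj])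
    have half: "ocnj ((1/2) *\<^sub>R ((if P then u else 0) + (if Q then ocnj u else 0)))
        = (1/2) *\<^sub>R ((if Q then u else 0) + (if P then ocnj u else 0))" for P Q u
      by (simp add: linear_scale[OF linear_ocnj] linear_add[OF linear_ocnj] c0)
    have "herm_frame i j u $ a $ b \<in> K" if "u \<in> K" for i j a b :: 'n and u
      using that cnj subspace_0[OF subspace]
      unfolding herm_frame_def vec_lambda_beta
      by (intro subspace_scale[OF subspace] subspace_add[OF subspace]) auto
    moreover have "ocnj (herm_frame i j u $ b $ a) = herm_frame i j u $ a $ b" for i j a b :: 'n and u
      unfolding herm_frame_def vec_lambda_beta half by (simp only: conj_commute)
    ultimately show "herm_frame (fst p) (fst (snd p)) (snd (snd p)) \<in> Herm K"
      using u by (simp add: Herm_def)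
  next
    fix w :: "octonion^'n^'n" assume w: "w \<in> Herm K"
    have "(\<Sum>i\<in>UNIV. \<Sum>j\<in>UNIV. \<Sum>u\<in>U. (w $ i $ j \<bullet> u) *\<^sub>R herm_frame i j u) $ a $ b = w $ a $ b" for a b
    proof -
      have inner: "(\<Sum>u\<in>U. (w $ i $ j \<bullet> u) *\<^sub>R herm_frame i j u $ a $ b)
          = (1/2) *\<^sub>R ((if a = i \<and> b = j then w $ i $ j else 0) + (if a = j \<and> b = i then w $ j $ i else 0))"
        for i j
      proof -
        have e: "(\<Sum>u\<in>U. (w $ i $ j \<bullet> u) *\<^sub>R u) = w $ i $ j"
          by (rule U(3)[rule_format, OF HermD(1)[OF w], symmetric])
        then have e': "(\<Sum>u\<in>U. (w $ i $ j \<bullet> u) *\<^sub>R ocnj u) = w $ j $ i"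
          using HermD(2)[OF w, of i j] linear_sum[OF linear_ocnj, of "\<lambda>u. (w $ i $ j \<bullet> u) *\<^sub>R u" U]
          by (simp add: linear_scale[OF linear_ocnj])
        have lin: "(\<Sum>u\<in>U. c u *\<^sub>R ((1/2) *\<^sub>R ((if P then u else 0) + (if Q then ocnj u else 0))))
            = (1/2) *\<^sub>R ((if P then \<Sum>u\<in>U. c u *\<^sub>R u else 0) + (if Q then \<Sum>u\<in>U. c u *\<^sub>R ocnj u else 0))"
          for P Q and c :: "octonion \<Rightarrow> real"
          by (cases P; cases Q) (simp_all add: scaleR_sum_right scaleR_add_right sum.distrib)
        show ?thesis
          unfolding herm_frame_def vec_lambda_beta lin e e' ..
      qed
      have one: "(\<Sum>i\<in>UNIV. \<Sum>j\<in>UNIV. if a = i \<and> b = j then h i j else 0) = h a b" for a b and h :: "'n \<Rightarrow> 'n \<Rightarrow> octonion"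
      proof -
        have "(\<Sum>j\<in>UNIV. if a = i \<and> b = j then h i j else 0) = (if a = i then h i b else 0)" for i
          by simp
        then show ?thesis by simp
      qed
      show ?thesis
        using one[of a b "\<lambda>i j. w $ i $ j"] one[of b a "\<lambda>i j. w $ j $ i"]
        by (simp add: inner scaleR_sum_right[symmetric] sum.distrib conj_commute flip: scaleR_2)
    qed
    then have "w = (\<Sum>i\<in>UNIV. \<Sum>j\<in>UNIV. \<Sum>u\<in>U. (w $ i $ j \<bullet> u) *\<^sub>R herm_frame i j u)"
      by (simp add: vec_eq_iff)
    then show "w = (\<Sum>p\<in>UNIV \<times> UNIV \<times> U. (w $ fst p $ fst (snd p) \<bullet> snd (snd p)) *\<^sub>R herm_frame (fst p) (fst (snd p)) (snd (snd p)))"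
      by (simp add: sum.cartesian_product case_prod_unfold)
  qed (use U f in \<open>auto simp: subspace_Herm inner_add_left linear_add linear_scale\<close>)
  then show ?thesis by (simp add: sum.cartesian_product)
qed

text \<open>
With \<open>d\<close> the dimension of the entry algebra, the frame vectors at \<open>(i, i)\<close> contribute \<open>x\<^sub>i\<^sub>i\<close> in total
and those at \<open>(i, j)\<close> contribute \<open>d (x\<^sub>i\<^sub>i + x\<^sub>j\<^sub>j) / 4\<close>, so the trace is \<open>1 + (n - 1) d / 2\<close> times the
trace of \<open>x\<close>. The same count for the identity shows that the dimension is \<open>n\<close> times this factor.
\<close>
lemma endo_trace_jordan:
  fixes x :: "octonion^'n^'n"
  assumes x: "x \<in> Herm K"
  shows "endo_trace (Herm K) ((\<star>) x) = mat_trace x / real CARD('n) * real (dim (Herm K :: (octonion^'n^'n) set))"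
proof -
  obtain U where "finite U \<and> U \<subseteq> K \<and> (\<forall>u\<in>U. norm u = 1) \<and> (\<forall>w\<in>K. w = (\<Sum>u\<in>U. (w \<bullet> u) *\<^sub>R u))"
    using Parseval_frame ..
  then have U: "finite U" "U \<subseteq> K" "\<And>u. u \<in> U \<Longrightarrow> norm u = 1"
    "\<forall>w\<in>K. w = (\<Sum>u\<in>U. (w \<bullet> u) *\<^sub>R u)"
    by simp_all
  define d where "d = real (card U)"
  note tr = endo_trace_Herm[OF U(1,2,4)]
  \<comment> \<open>Parseval for the unit; it replaces the assumption that the unit belongs to \<open>U\<close>\<close>
  have one: "(\<Sum>u\<in>U. (oRe u)\<^sup>2) = 1"
  proof -
    have "1 = oct_of_real 1 \<bullet> oct_of_real 1" by (simp add: dot_square_norm)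
    also have "\<dots> = (\<Sum>u\<in>U. (oct_of_real 1 \<bullet> u) *\<^sub>R u) \<bullet> oct_of_real 1"
      by (simp only: U(4)[rule_format, OF one, symmetric])
    finally show ?thesis
      by (simp add: inner_sum_right oRe_inner inner_commute power2_eq_square)
  qed
  have vd: "herm_frame i i u = (\<chi> a b. if a = i \<and> b = i then oct_of_real (oRe u) else 0)" for i u
    by (simp add: herm_frame_def vec_eq_iff ocnj_eq oct_of_real_scaleR[of "oRe u"])
  define a where "a i = oRe (x $ i $ i)" for i
  have a: "x $ i $ i = oct_of_real (a i)" for i
    unfolding a_def by (rule HermD(3)[OF x])
  have off: "(\<Sum>u\<in>U. (x \<star> herm_frame i j u) $ i $ j \<bullet> u) = d * (a i + a j) / 4"
    if "i \<noteq> j" for i j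
  proof -
    have "(x \<star> herm_frame i j u) $ i $ j \<bullet> u = (a i + a j) / 4" if u: "u \<in> U" for u
    proof -
      have "x $ i $ l \<otimes>\<^sub>O herm_frame i j u $ l $ j = (if l = i then (a i / 2) *\<^sub>R u else 0)" for l
        using \<open>i \<noteq> j\<close> by (auto simp: herm_frame_def omul.scaleR_right a)
      moreover have "herm_frame i j u $ i $ l \<otimes>\<^sub>O x $ l $ j = (if l = j then (a j / 2) *\<^sub>R u else 0)" for l
        using \<open>i \<noteq> j\<close> by (auto simp: herm_frame_def omul.scaleR_left a)
      ultimately have "(x \<star> herm_frame i j u) $ i $ j = (1/2) *\<^sub>R ((a i / 2) *\<^sub>R u + (a j / 2) *\<^sub>R u)"
        by (simp add: jordan_nth sum.distrib)
      then show ?thesis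
        using U(3)[OF u] by (simp add: dot_square_norm inner_add_left)
    qed
    then have "(\<Sum>u\<in>U. (x \<star> herm_frame i j u) $ i $ j \<bullet> u) = (\<Sum>u\<in>U. (a i + a j) / 4)"
      by (intro sum.cong refl)
    then show ?thesis by (simp add: d_def)
  qed
  have diag: "(\<Sum>u\<in>U. (x \<star> herm_frame i i u) $ i $ i \<bullet> u) = a i" for i
  proof -
    have "(x \<star> herm_frame i i u) $ i $ i \<bullet> u = a i * (oRe u)\<^sup>2" for u
    proof -
      have "x $ i $ l \<otimes>\<^sub>O herm_frame i i u $ l $ i = (if l = i then oRe u *\<^sub>R x $ i $ i else 0)"
        "herm_frame i i u $ i $ l \<otimes>\<^sub>O x $ l $ i = (if l = i then oRe u *\<^sub>R x $ i $ i else 0)" for l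
        by (auto simp: vd)
      then have "(x \<star> herm_frame i i u) $ i $ i = (a i * oRe u) *\<^sub>R oct_of_real 1"
        by (simp add: jordan_nth sum.distrib a oct_of_real_scaleR[of "a i"] mult.commute)
      then show ?thesis
        by (simp add: oRe_inner[of u] inner_commute power2_eq_square)
    qed
    then show ?thesis by (simp add: one flip: sum_distrib_left)
  qed
  have offid: "(\<Sum>u\<in>U. herm_frame i j u $ i $ j \<bullet> u) = d / 2" if "i \<noteq> j" for i j
    using that U(3) by (simp add: herm_frame_def dot_square_norm d_def)
  have diagid: "(\<Sum>u\<in>U. herm_frame i i u $ i $ i \<bullet> u) = 1" for i
  proof -
    have "herm_frame i i u $ i $ i \<bullet> u = (oRe u)\<^sup>2" for u
    proof -
      have "herm_frame i i u $ i $ i = oRe u *\<^sub>R oct_of_real 1"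
        by (simp add: vd flip: oct_of_real_scaleR)
      then show ?thesis
        by (simp add: oRe_inner[of u] inner_commute power2_eq_square)
    qed
    then show ?thesis by (simp add: one)
  qed
  have split: "(\<Sum>j\<in>UNIV. g j) = g i + (\<Sum>j\<in>UNIV-{i}. g j)" for g :: "'n \<Rightarrow> real" and i
    by (simp add: sum.remove)
  define n where "n = real CARD('n)"
  have cm: "(\<Sum>j\<in>UNIV-{i}. 1 :: real) = n - 1" for i :: 'n
    by (simp add: n_def of_nat_diff)
  have N: "real (dim (Herm K :: (octonion^'n^'n) set)) = n * (1 + (n - 1) * d / 2)"
  proof -
    have "real (dim (Herm K :: (octonion^'n^'n) set)) = (\<Sum>i::'n\<in>UNIV. \<Sum>j\<in>UNIV. \<Sum>u\<in>U. herm_frame i j u $ i $ j \<bullet> u)"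
      by (rule trans[OF endo_trace_id[OF subspace_Herm, symmetric] tr[OF linear_ident]])
    also have "\<dots> = (\<Sum>i::'n\<in>UNIV. 1 + (n - 1) * d / 2)"
    proof (rule sum.cong[OF refl])
      fix i :: 'n
      show "(\<Sum>j\<in>UNIV. \<Sum>u\<in>U. herm_frame i j u $ i $ j \<bullet> u) = 1 + (n - 1) * d / 2"
        using cm[of i] by (subst split[of _ i]) (simp add: diagid offid)
    qed
    finally show ?thesis by (simp add: n_def)
  qed
  have "endo_trace (Herm K) ((\<star>) x) = (\<Sum>i\<in>UNIV. \<Sum>j\<in>UNIV. \<Sum>u\<in>U. (x \<star> herm_frame i j u) $ i $ j \<bullet> u)"
    by (rule tr[OF bounded_linear.linear[OF jordan.bounded_linear_right] jordan_Herm[OF x]])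
  also have "\<dots> = (\<Sum>i\<in>UNIV. a i + (\<Sum>j\<in>UNIV-{i}. d * (a i + a j) / 4))"
  proof (rule sum.cong[OF refl])
    fix i :: 'n
    show "(\<Sum>j\<in>UNIV. \<Sum>u\<in>U. (x \<star> herm_frame i j u) $ i $ j \<bullet> u)
      = a i + (\<Sum>j\<in>UNIV-{i}. d * (a i + a j) / 4)"
      by (subst split[of _ i]) (simp add: diag off)
  qed
  also have "\<dots> = (\<Sum>i\<in>UNIV. a i + d / 4 * (n * a i + mat_trace x - 2 * a i))"
  proof (rule sum.cong[OF refl])
    fix i :: 'n
    have "(\<Sum>j\<in>UNIV-{i}. d * (a i + a j) / 4)
      = d / 4 * (\<Sum>j\<in>UNIV-{i}. a i + a j)"
      by (simp add: sum_distrib_left)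
    also have "(\<Sum>j\<in>UNIV-{i}. a i + a j) = n * a i + mat_trace x - 2 * a i"
      using split[of "\<lambda>j. a i + a j" i]
      by (simp add: sum.distrib n_def mat_trace_eq a_def)
    finally show "a i + (\<Sum>j\<in>UNIV-{i}. d * (a i + a j) / 4)
      = a i + d / 4 * (n * a i + mat_trace x - 2 * a i)" by simp
  qed
  also have "\<dots> = (\<Sum>i\<in>UNIV. (1 + (n - 2) * d / 4) * a i + d / 4 * mat_trace x)"
    by (simp add: algebra_simps add_divide_distrib diff_divide_distrib)
  also have "\<dots> = (1 + (n - 2) * d / 4) * mat_trace x + n * (d / 4 * mat_trace x)"
    by (simp add: sum.distrib mat_trace_eq a_def n_def flip: sum_distrib_left)
  also have "\<dots> = mat_trace x * (1 + (n - 1) * d / 2)"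
    by (simp add: field_simps)
  also have "\<dots> = mat_trace x / n * real (dim (Herm K :: (octonion^'n^'n) set))"
    by (simp add: N n_def)
  finally show ?thesis by (simp add: n_def)
qed

lemma dim_Herm_pos: "0 < dim (Herm K :: (octonion^'n^'n) set)"
proof -
  define e :: "octonion^'n^'n" where "e = (\<chi> i j. if i = j then oct_of_real 1 else 0)"
  have "e \<in> Herm K"
    using one subspace_0[OF subspace] linear_0[OF linear_ocnj] oct_of_real_hom(2)[of 1]
    by (auto simp: Herm_def e_def)
  moreover have "e \<noteq> 0"
  proof
    assume "e = 0"
    then have "norm (e $ undefined $ undefined) = 0" by simp
    then show False by (simp add: e_def)
  qed
  ultimately have "dim (Herm K :: (octonion^'n^'n) set) \<noteq> 0"
    by (auto simp: dim_eq_0)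
  then show ?thesis by (simp del: dim_eq_0)
qed

theorem hhat_trace:
  fixes x y :: "octonion^'n^'n"
  assumes "x \<in> Herm K" "y \<in> Herm K"
  shows "hhat K x y = mat_trace (x \<star> y) / real CARD('n)"
  using endo_trace_jordan[OF jordan_Herm[OF assms]] dim_Herm_pos[where 'n = 'n]
  by (simp add: hhat_def del: dim_eq_0)

lemma hhat_inner:
  fixes x y :: "octonion^'n^'n"
  assumes "x \<in> Herm K" "y \<in> Herm K"
  shows "hhat K x y = (x \<bullet> y) / real CARD('n)"
  using hhat_trace[OF assms] mat_trace_jordan_Herm[OF assms(2)] by simp

text \<open>
The operator of multiplication by \<open>f (x \<star> y)\<close> is conjugate under \<open>f\<close> to that of multiplication by \<open>x \<star> y\<close>.
\<close>
lemma hhat_Aut: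
  fixes x y :: "octonion^'n^'n"
  assumes f: "f \<in> Aut_Herm K" and x: "x \<in> Herm K" and y: "y \<in> Herm K"
  shows "hhat K (f x) (f y) = hhat K x y"
proof -
  from f have f: "bij_betw f (Herm K) (Herm K)"
    "\<And>a b. a \<in> Herm K \<Longrightarrow> b \<in> Herm K \<Longrightarrow> f (a + b) = f a + f b"
    "\<And>c a. a \<in> Herm K \<Longrightarrow> f (c *\<^sub>R a) = c *\<^sub>R f a"
    "\<And>a b. a \<in> Herm K \<Longrightarrow> b \<in> Herm K \<Longrightarrow> f (a \<star> b) = f a \<star> f b"
    by (auto simp: Aut_Herm_def)
  have fH: "f a \<in> Herm K" if "a \<in> Herm K" for a
    using f(1) that by (auto simp: bij_betw_def)
  have "endo_trace (Herm K) ((\<star>) (f x \<star> f y)) = endo_trace (Herm K) ((\<star>) (x \<star> y))"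
    by (rule endo_trace_conj[OF subspace_Herm f(1-3)])
       (simp_all add: jordan_Herm x y fH f(4) jordan.add_right jordan.scaleR_right)
  then show ?thesis by (simp add: hhat_def)
qed

end

section \<open>Isometric automorphisms\<close>

text \<open>
The norm is required to be preserved on all matrices and not only on Hermitian ones. This makes the set
of these maps bounded in the operator norm, hence compact.
\<close>
definition jordan_isometry :: "octonion set \<Rightarrow> (octonion^'n^'n \<Rightarrow> octonion^'n^'n) \<Rightarrow> bool"
  where "jordan_isometry K F \<longleftrightarrow> linear F \<and> (\<forall>z. norm (F z) = norm z)
    \<and> (\<forall>x\<in>Herm K. F x \<in> Herm K) \<and> (\<forall>x\<in>Herm K. \<forall>y\<in>Herm K. F (x \<star> y) = F x \<star> F y)"

lemma jordan_isometryD: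
  assumes "jordan_isometry K F"
  shows "linear F" "norm (F z) = norm z" "x \<in> Herm K \<Longrightarrow> F x \<in> Herm K"
    "x \<in> Herm K \<Longrightarrow> y \<in> Herm K \<Longrightarrow> F (x \<star> y) = F x \<star> F y"
    "F x \<bullet> F y = x \<bullet> y"
proof -
  show "linear F" "norm (F z) = norm z" for z
    using assms by (simp_all add: jordan_isometry_def)
  then have "orthogonal_transformation F"
    by (simp add: orthogonal_transformation)
  then show "F x \<bullet> F y = x \<bullet> y"
    by (simp add: orthogonal_transformation_def)
qed (use assms in \<open>simp_all add: jordan_isometry_def\<close>)

lemma jordan_isometry_id: "jordan_isometry K (\<lambda>x. x)"
  by (simp add: jordan_isometry_def linear_ident)

lemma jordan_isometry_compose:
  assumes "jordan_isometry K F" "jordan_isometry K G"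
  shows "jordan_isometry K (\<lambda>x. F (G x))"
  using assms linear_compose[of G F] by (auto simp: jordan_isometry_def o_def)

text \<open>
An isometry is injective, and an injective linear map of a finite-dimensional space into itself is onto.
\<close>
lemma (in hurwitz_subalgebra) jordan_isometry_Aut:
  fixes F :: "octonion^'n^'n \<Rightarrow> octonion^'n^'n"
  assumes F: "jordan_isometry K F"
  shows "F \<in> Aut_Herm K"
proof -
  let ?H = "Herm K :: (octonion^'n^'n) set"
  note F = jordan_isometryD[OF F]
  have "F a = F b \<Longrightarrow> a = b" for a b
    using F(2)[of "a - b"] linear_diff[OF F(1), of a b] by simp
  then have inj: "inj F" by (rule injI)
  have "F ` Herm K = Herm K"
  proof (rule subspace_dim_equal)
    show "subspace (F ` Herm K)"
      using F(1) subspace_Herm by (rule linear_subspace_image)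
    show "dim ?H \<le> dim (F ` ?H)"
      using dim_image_eq[OF F(1) inj_on_subset[OF inj subset_UNIV]] by simp
  qed (use F subspace_Herm in auto)
  then have "bij_betw F (Herm K) (Herm K)"
    using inj inj_on_subset[OF inj subset_UNIV] by (simp add: bij_betw_def)
  then show ?thesis
    using F by (simp add: Aut_Herm_def linear_add linear_scale)
qed

definition permute_mat :: "('n \<Rightarrow> 'n) \<Rightarrow> octonion^'n^'n \<Rightarrow> octonion^'n^'n"
  where "permute_mat \<sigma> x = (\<chi> i j. x $ \<sigma> i $ \<sigma> j)"

lemma jordan_isometry_permute:
  assumes "bij \<sigma>"
  shows "jordan_isometry K (permute_mat \<sigma>)"
proof -
  have reindex: "(\<Sum>i\<in>UNIV. f (\<sigma> i)) = (\<Sum>i\<in>UNIV. f i)" for f :: "'a \<Rightarrow> 'b::comm_monoid_add"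
    using sum.reindex_bij_betw[OF assms] .
  have "linear (permute_mat \<sigma>)"
    by (intro linearI) (simp_all add: permute_mat_def vec_eq_iff)
  moreover have "norm (permute_mat \<sigma> z) = norm z" for z
  proof -
    have "permute_mat \<sigma> z \<bullet> permute_mat \<sigma> z = (\<Sum>i\<in>UNIV. \<Sum>j\<in>UNIV. z $ \<sigma> i $ j \<bullet> z $ \<sigma> i $ j)"
      by (simp add: inner_vec_def permute_mat_def reindex[of "\<lambda>j. z $ _ $ j \<bullet> z $ _ $ j"])
    also have "\<dots> = z \<bullet> z"
      by (simp add: inner_vec_def reindex[of "\<lambda>i. \<Sum>j\<in>UNIV. z $ i $ j \<bullet> z $ i $ j"])
    finally show ?thesis by (simp add: norm_eq_sqrt_inner)
  qed
  moreover have "permute_mat \<sigma> (x \<star> y) = permute_mat \<sigma> x \<star> permute_mat \<sigma> y" for x y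
    by (simp add: vec_eq_iff permute_mat_def jordan_nth
        reindex[of "\<lambda>l. x $ _ $ l \<otimes>\<^sub>O y $ l $ _ + y $ _ $ l \<otimes>\<^sub>O x $ l $ _"])
  ultimately show ?thesis
    by (auto simp: jordan_isometry_def Herm_def permute_mat_def)
qed

text \<open>
Real matrices act on octonion matrices from the left; the action from the right is obtained by
transposing. Real entries associate with everything, so conjugation with a real orthogonal matrix is
an automorphism over all four algebras.
\<close>
definition real_act :: "real^'n^'n \<Rightarrow> octonion^'n^'n \<Rightarrow> octonion^'n^'n"
  where "real_act Q x = (\<chi> i j. \<Sum>k\<in>UNIV. Q $ i $ k *\<^sub>R x $ k $ j)"

definition real_conj :: "real^'n^'n \<Rightarrow> octonion^'n^'n \<Rightarrow> octonion^'n^'n"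
  where "real_conj Q x = real_act Q (transpose (real_act Q (transpose x)))"

lemma real_conj_nth: "real_conj Q x $ i $ j = (\<Sum>k\<in>UNIV. Q $ i $ k *\<^sub>R (\<Sum>l\<in>UNIV. Q $ j $ l *\<^sub>R x $ k $ l))"
  by (simp add: real_conj_def real_act_def transpose_def)

lemma linear_real_act: "linear (real_act Q)"
  by (intro linearI) (simp_all add: real_act_def vec_eq_iff scaleR_add_right sum.distrib scaleR_sum_right mult.commute)

lemma real_act_cancel:
  assumes "orthogonal_matrix Q"
  shows "real_act (transpose Q) (real_act Q x) = x"
proof -
  have "real_act (transpose Q) (real_act Q x) = real_act (transpose Q ** Q) x"
    by (simp add: real_act_def matrix_matrix_mult_def vec_eq_iff scaleR_sum_right scaleR_sum_left)
       (subst sum.swap, simp)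
  also have "transpose Q ** Q = mat 1"
    using assms by (simp add: orthogonal_matrix_def)
  finally show ?thesis
    by (simp add: real_act_def mat_def vec_eq_iff if_distrib[of "\<lambda>c. c *\<^sub>R _"] cong: if_cong)
qed

lemma real_act_adjoint: "real_act Q x \<bullet> y = x \<bullet> real_act (transpose Q) y"
proof -
  have "real_act Q x \<bullet> y = (\<Sum>i\<in>UNIV. \<Sum>j\<in>UNIV. \<Sum>k\<in>UNIV. Q $ i $ k * (x $ k $ j \<bullet> y $ i $ j))"
    by (simp add: inner_vec_def real_act_def inner_sum_left)
  also have "\<dots> = (\<Sum>i\<in>UNIV. \<Sum>k\<in>UNIV. \<Sum>j\<in>UNIV. Q $ i $ k * (x $ k $ j \<bullet> y $ i $ j))"
    by (intro sum.cong refl sum.swap)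
  also have "\<dots> = (\<Sum>k\<in>UNIV. \<Sum>i\<in>UNIV. \<Sum>j\<in>UNIV. Q $ i $ k * (x $ k $ j \<bullet> y $ i $ j))"
    by (rule sum.swap)
  also have "\<dots> = (\<Sum>k\<in>UNIV. \<Sum>j\<in>UNIV. \<Sum>i\<in>UNIV. Q $ i $ k * (x $ k $ j \<bullet> y $ i $ j))"
    by (intro sum.cong refl sum.swap)
  also have "\<dots> = x \<bullet> real_act (transpose Q) y"
    by (simp add: inner_vec_def real_act_def inner_sum_right transpose_def)
  finally show ?thesis .
qed

lemma norm_real_act:
  assumes "orthogonal_matrix Q"
  shows "norm (real_act Q x) = norm x"
  by (simp add: norm_eq_sqrt_inner real_act_adjoint real_act_cancel[OF assms])

lemma norm_transpose: "norm (transpose x) = norm (x :: octonion^'n^'n)"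
proof -
  have "transpose x \<bullet> transpose x = x \<bullet> x"
    unfolding inner_vec_def transpose_def vec_lambda_beta by (rule sum.swap)
  then show ?thesis by (simp add: norm_eq_sqrt_inner)
qed

lemma mmul_real_act_left: "mmul (real_act Q x) y = real_act Q (mmul x y)"
  by (simp add: vec_eq_iff mmul_nth real_act_def omul.sum_left omul.scaleR_left scaleR_sum_right)
     (intro allI sum.swap)

lemma mmul_real_act_right:
  "mmul x (transpose (real_act Q (transpose y))) = transpose (real_act Q (transpose (mmul x y)))"
  by (simp add: vec_eq_iff mmul_nth real_act_def transpose_def omul.sum_right omul.scaleR_right scaleR_sum_right)
     (intro allI sum.swap)

lemma mmul_real_act_middle:
  "mmul (transpose (real_act Q (transpose x))) y = mmul x (real_act (transpose Q) y)"
  by (simp add: vec_eq_iff mmul_nth real_act_def transpose_def omul.sum_right omul.scaleR_right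
      omul.sum_left omul.scaleR_left)
     (intro allI sum.swap)

lemma mmul_real_conj:
  assumes "orthogonal_matrix Q"
  shows "mmul (real_conj Q x) (real_conj Q y) = real_conj Q (mmul x y)"
  by (simp add: real_conj_def mmul_real_act_left mmul_real_act_middle mmul_real_act_right
      real_act_cancel[OF assms])

lemma linear_real_conj: "linear (real_conj Q)"
proof -
  have t: "transpose (x + y) = transpose x + transpose y" "transpose (c *\<^sub>R x) = c *\<^sub>R transpose x"
    for x y :: "octonion^'n^'n" and c
    by (simp_all add: transpose_def vec_eq_iff)
  show ?thesis
    by (intro linearI)
       (simp_all add: real_conj_def t linear_add[OF linear_real_act] linear_scale[OF linear_real_act])
qed

lemma (in hurwitz_subalgebra) jordan_isometry_real_conj:
  assumes Q: "orthogonal_matrix Q"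
  shows "jordan_isometry K (real_conj Q)"
proof -
  have "real_conj Q x \<in> Herm K" if x: "x \<in> Herm K" for x
  proof -
    have "real_conj Q x $ i $ j \<in> K" for i j
      unfolding real_conj_nth by (intro subspace_sum subspace_scale subspace HermD[OF x])
    moreover have "ocnj (real_conj Q x $ j $ i) = real_conj Q x $ i $ j" for i j
    proof -
      have "ocnj (real_conj Q x $ j $ i) = (\<Sum>k\<in>UNIV. \<Sum>l\<in>UNIV. (Q $ j $ k * Q $ i $ l) *\<^sub>R x $ l $ k)"
        by (simp add: real_conj_nth linear_sum[OF linear_ocnj] linear_scale[OF linear_ocnj] HermD(2)[OF x]
            scaleR_sum_right)
      also have "\<dots> = (\<Sum>l\<in>UNIV. \<Sum>k\<in>UNIV. (Q $ j $ k * Q $ i $ l) *\<^sub>R x $ l $ k)"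
        by (rule sum.swap)
      also have "\<dots> = real_conj Q x $ i $ j"
        by (simp add: real_conj_nth scaleR_sum_right mult.commute)
      finally show ?thesis .
    qed
    ultimately show ?thesis by (simp add: Herm_def)
  qed
  moreover have "real_conj Q (x \<star> y) = real_conj Q x \<star> real_conj Q y" for x y
    using linear_real_conj[of Q]
    by (simp add: jordan_def mmul_real_conj[OF Q] linear_add linear_scale)
  ultimately show ?thesis
    by (simp add: jordan_isometry_def linear_real_conj)
       (simp add: real_conj_def norm_real_act[OF Q] norm_transpose)
qed

lemma norm_entrywise:
  assumes "\<And>i j. norm (x $ i $ j) = norm (y $ i $ j)"
  shows "norm x = norm (y :: octonion^'n^'n)"
  using assms by (simp add: norm_vec_def)

lemma unit_phase:
  assumes "norm u = 1"
  shows "ocnj u \<otimes>\<^sub>O (u \<otimes>\<^sub>O a) = a" "u \<otimes>\<^sub>O (ocnj u \<otimes>\<^sub>O a) = a"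
    "(a \<otimes>\<^sub>O ocnj u) \<otimes>\<^sub>O u = a"
proof -
  show "ocnj u \<otimes>\<^sub>O (u \<otimes>\<^sub>O a) = a"
    using assms by (simp add: omul_cancel_left)
  show "u \<otimes>\<^sub>O (ocnj u \<otimes>\<^sub>O a) = a"
    using assms omul_cancel_left[of "ocnj u" a] by simp
  have "ocnj ((a \<otimes>\<^sub>O ocnj u) \<otimes>\<^sub>O u) = ocnj a"
    using assms omul_cancel_left[of u "ocnj a"] by (simp add: ocnj_omul)
  then show "(a \<otimes>\<^sub>O ocnj u) \<otimes>\<^sub>O u = a" by (metis ocnj_ocnj)
qed

text \<open>
Conjugation with the diagonal matrix of the units \<open>d i\<close>, an automorphism when the entries associate.
\<close>
definition diag_phase :: "('n \<Rightarrow> octonion) \<Rightarrow> octonion^'n^'n \<Rightarrow> octonion^'n^'n"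
  where "diag_phase d x = (\<chi> i j. (d i \<otimes>\<^sub>O x $ i $ j) \<otimes>\<^sub>O ocnj (d j))"

lemma (in hurwitz_subalgebra) jordan_isometry_diag_phase:
  assumes assoc: "assoc_on K" and d: "\<And>i. d i \<in> K" "\<And>i. norm (d i) = 1"
  shows "jordan_isometry K (diag_phase d)"
proof -
  have as: "(a \<otimes>\<^sub>O b) \<otimes>\<^sub>O c = a \<otimes>\<^sub>O (b \<otimes>\<^sub>O c)" if "a \<in> K" "b \<in> K" "c \<in> K" for a b c
    using assoc that by (simp add: assoc_on_def)
  have lin: "linear (diag_phase d)"
    by (intro linearI)
       (simp_all add: diag_phase_def vec_eq_iff omul.add_left omul.add_right omul.scaleR_left omul.scaleR_right)
  have herm: "diag_phase d x \<in> Herm K" if x: "x \<in> Herm K" for x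
    using HermD[OF x] d cnj mult as by (simp add: Herm_def diag_phase_def ocnj_omul)
  have hom: "mmul (diag_phase d x) (diag_phase d y) = diag_phase d (mmul x y)"
    if x: "x \<in> Herm K" and y: "y \<in> Herm K" for x y
  proof -
    have "((p \<otimes>\<^sub>O a) \<otimes>\<^sub>O ocnj q) \<otimes>\<^sub>O ((q \<otimes>\<^sub>O b) \<otimes>\<^sub>O ocnj r) = (p \<otimes>\<^sub>O (a \<otimes>\<^sub>O b)) \<otimes>\<^sub>O ocnj r"
      if "p \<in> K" "q \<in> K" "r \<in> K" "a \<in> K" "b \<in> K" "norm q = 1" for p q r a b
    proof -
      have "((p \<otimes>\<^sub>O a) \<otimes>\<^sub>O ocnj q) \<otimes>\<^sub>O ((q \<otimes>\<^sub>O b) \<otimes>\<^sub>O ocnj r)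
          = p \<otimes>\<^sub>O (a \<otimes>\<^sub>O (ocnj q \<otimes>\<^sub>O (q \<otimes>\<^sub>O (b \<otimes>\<^sub>O ocnj r))))"
        using that by (simp add: as mult cnj)
      also have "\<dots> = (p \<otimes>\<^sub>O (a \<otimes>\<^sub>O b)) \<otimes>\<^sub>O ocnj r"
        using that by (simp add: as mult cnj unit_phase(1))
      finally show ?thesis .
    qed
    then have "mmul (diag_phase d x) (diag_phase d y) $ i $ j
        = (\<Sum>l\<in>UNIV. (d i \<otimes>\<^sub>O (x $ i $ l \<otimes>\<^sub>O y $ l $ j)) \<otimes>\<^sub>O ocnj (d j))" for i j
      unfolding mmul_nth by (intro sum.cong) (simp_all add: diag_phase_def d HermD[OF x] HermD[OF y])
    then show ?thesis
      by (simp add: vec_eq_iff diag_phase_def mmul_nth omul.sum_left omul.sum_right)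
  qed
  have "diag_phase d (x \<star> y) = diag_phase d x \<star> diag_phase d y" if "x \<in> Herm K" "y \<in> Herm K" for x y
    using that by (simp add: jordan_def hom linear_add[OF lin] linear_scale[OF lin])
  moreover have "norm (diag_phase d z) = norm z" for z
    by (rule norm_entrywise) (simp add: diag_phase_def norm_omul d)
  ultimately show ?thesis
    using lin herm by (simp add: jordan_isometry_def)
qed

text \<open>
The substitute for a diagonal conjugation over the octonions: at the positions \<open>(i, j)\<close>, \<open>(j, k)\<close> and
\<open>(i, k)\<close> the entry is multiplied by \<open>u\<close> from the left, from the right, and from both sides. The remaining
cases are dictated by Hermitian symmetry.
\<close>
definition triality_phase :: "octonion \<Rightarrow> 'n \<Rightarrow> 'n \<Rightarrow> 'n \<Rightarrow> octonion^'n^'n \<Rightarrow> octonion^'n^'n"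
  where "triality_phase u i j k x = (\<chi> a b.
    if a = i \<and> b = j then u \<otimes>\<^sub>O x $ i $ j
    else if a = j \<and> b = i then x $ j $ i \<otimes>\<^sub>O ocnj u
    else if a = j \<and> b = k then x $ j $ k \<otimes>\<^sub>O u
    else if a = k \<and> b = j then ocnj u \<otimes>\<^sub>O x $ k $ j
    else if a = i \<and> b = k then (u \<otimes>\<^sub>O x $ i $ k) \<otimes>\<^sub>O u
    else if a = k \<and> b = i then ocnj u \<otimes>\<^sub>O (x $ k $ i \<otimes>\<^sub>O ocnj u)
    else x $ a $ b)"

lemma jordan_nth_diag:
  assumes x: "x \<in> Herm K" and y: "y \<in> Herm K"
  shows "(x \<star> y) $ i $ i = oct_of_real (\<Sum>l\<in>UNIV. x $ i $ l \<bullet> y $ i $ l)"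
proof -
  have "x $ i $ l \<otimes>\<^sub>O y $ l $ i + y $ i $ l \<otimes>\<^sub>O x $ l $ i = (2 * (x $ i $ l \<bullet> y $ i $ l)) *\<^sub>R oct_of_real 1" for l
    using omul_polar[of "x $ i $ l" "y $ i $ l"] HermD(2)[OF x] HermD(2)[OF y]
    by (simp flip: oct_of_real_scaleR)
  then have "(x \<star> y) $ i $ i = (\<Sum>l\<in>UNIV. x $ i $ l \<bullet> y $ i $ l) *\<^sub>R oct_of_real 1"
    by (simp add: jordan_nth scaleR_sum_left scaleR_sum_right)
  then show ?thesis by (simp flip: oct_of_real_scaleR)
qed

text \<open>
Since the diagonal entries are real, only the third index brings in a genuine octonion product; for
\<open>3 \<times> 3\<close> matrices this is a single pair of terms.
\<close>
lemma jordan_nth_offdiag: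
  assumes x: "x \<in> Herm K" and y: "y \<in> Herm K" and ab: "a \<noteq> b"
  shows "(x \<star> y) $ a $ b = (1/2) *\<^sub>R ((oRe (x $ a $ a) + oRe (x $ b $ b)) *\<^sub>R y $ a $ b
     + (oRe (y $ a $ a) + oRe (y $ b $ b)) *\<^sub>R x $ a $ b
     + (\<Sum>l\<in>UNIV-{a,b}. x $ a $ l \<otimes>\<^sub>O y $ l $ b + y $ a $ l \<otimes>\<^sub>O x $ l $ b))"
proof -
  have s: "(\<Sum>l\<in>UNIV. g l) = g a + (g b + (\<Sum>l\<in>UNIV-{a,b}. g l))" for g :: "'a \<Rightarrow> octonion"
  proof -
    have "UNIV - {a, b} = UNIV - {a} - {b}" by auto
    then show ?thesis
      using ab sum.remove[of UNIV a g] sum.remove[of "UNIV - {a}" b g] by simp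
  qed
  have d: "p \<otimes>\<^sub>O x $ c $ c = oRe (x $ c $ c) *\<^sub>R p" "x $ c $ c \<otimes>\<^sub>O p = oRe (x $ c $ c) *\<^sub>R p"
    "p \<otimes>\<^sub>O y $ c $ c = oRe (y $ c $ c) *\<^sub>R p" "y $ c $ c \<otimes>\<^sub>O p = oRe (y $ c $ c) *\<^sub>R p" for c p
    using arg_cong[OF HermD(3)[OF x, of c], of "\<lambda>z. p \<otimes>\<^sub>O z"] arg_cong[OF HermD(3)[OF x, of c], of "\<lambda>z. z \<otimes>\<^sub>O p"]
      arg_cong[OF HermD(3)[OF y, of c], of "\<lambda>z. p \<otimes>\<^sub>O z"] arg_cong[OF HermD(3)[OF y, of c], of "\<lambda>z. z \<otimes>\<^sub>O p"]
    by (simp_all only: omul_oct_of_real)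
  show ?thesis
    unfolding jordan_nth s d by (simp add: algebra_simps)
qed

text \<open>
On the diagonal the product involves inner products of entries only, which are preserved. At each of the
three off-diagonal positions the compatibility is one of the Moufang identities.
\<close>
lemma (in hurwitz_subalgebra) jordan_isometry_triality_phase:
  fixes i j k :: "'n::finite"
  assumes u: "u \<in> K" "norm u = 1" and ijk: "UNIV = {i, j, k}" "i \<noteq> j" "i \<noteq> k" "j \<noteq> k"
  shows "jordan_isometry K (triality_phase u i j k)"
    and "norm (triality_phase u i j k x $ a $ b) = norm (x $ a $ b)"
proof -
  define F where "F = triality_phase u i j k"
  have F: "F x $ i $ j = u \<otimes>\<^sub>O x $ i $ j" "F x $ j $ i = x $ j $ i \<otimes>\<^sub>O ocnj u"
    "F x $ j $ k = x $ j $ k \<otimes>\<^sub>O u" "F x $ k $ j = ocnj u \<otimes>\<^sub>O x $ k $ j"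
    "F x $ i $ k = (u \<otimes>\<^sub>O x $ i $ k) \<otimes>\<^sub>O u" "F x $ k $ i = ocnj u \<otimes>\<^sub>O (x $ k $ i \<otimes>\<^sub>O ocnj u)"
    "F x $ c $ c = x $ c $ c" for x c
    using ijk by (auto simp: F_def triality_phase_def)
  \<comment> \<open>check a property of pairs of indices position by position\<close>
  have all: "P" if "\<And>c. Q c c" "Q i j" "Q j i" "Q j k" "Q k j" "Q i k" "Q k i"
    "(\<And>a b. Q a b) \<Longrightarrow> P" for P Q
  proof (rule that(8))
    fix a b
    have "a \<in> {i, j, k}" "b \<in> {i, j, k}" using ijk(1) by auto
    then show "Q a b" using that(1-7) by auto
  qed
  have lin: "linear F"
  proof (rule linearI)
    show "F (x + y) = F x + F y" for x y
      unfolding vec_eq_iff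
      by (rule all[where Q = "\<lambda>a b. F (x + y) $ a $ b = (F x + F y) $ a $ b"])
         (simp_all add: F omul.add_left omul.add_right)
    show "F (c *\<^sub>R x) = c *\<^sub>R F x" for c x
      unfolding vec_eq_iff
      by (rule all[where Q = "\<lambda>a b. F (c *\<^sub>R x) $ a $ b = (c *\<^sub>R F x) $ a $ b"])
         (simp_all add: F omul.scaleR_left omul.scaleR_right)
  qed
  have norm_F: "norm (F x $ a $ b) = norm (x $ a $ b)" for x a b
    by (rule all[where Q = "\<lambda>a b. norm (F x $ a $ b) = norm (x $ a $ b)"])
       (auto simp: F norm_omul u)
  have inner_F: "F x $ a $ b \<bullet> F y $ a $ b = x $ a $ b \<bullet> y $ a $ b" for x y a b
    using norm_F[of "x + y" a b] norm_F[of x a b] norm_F[of y a b]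
    by (simp add: linear_add[OF lin] norm_eq inner_add inner_commute)
  have herm: "F x \<in> Herm K" if x: "x \<in> Herm K" for x
  proof -
    have "F x $ a $ b \<in> K" for a b
      by (rule all[where Q = "\<lambda>a b. F x $ a $ b \<in> K"]) (auto simp: F u HermD(1)[OF x] cnj mult)
    moreover have "ocnj (F x $ b $ a) = F x $ a $ b" for a b
      by (rule all[where Q = "\<lambda>a b. ocnj (F x $ b $ a) = F x $ a $ b"])
         (auto simp: F HermD(2)[OF x] ocnj_omul)
    ultimately show ?thesis by (simp add: Herm_def)
  qed
  have hom: "F (x \<star> y) = F x \<star> F y" if x: "x \<in> Herm K" and y: "y \<in> Herm K" for x y
  proof -
    note J = jordan_nth_offdiag[OF x y] jordan_nth_offdiag[OF herm[OF x] herm[OF y]]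
    have U: "UNIV - {i, j} = {k}" "UNIV - {j, k} = {i}" "UNIV - {i, k} = {j}"
      using ijk by auto
    have ij: "F (x \<star> y) $ i $ j = (F x \<star> F y) $ i $ j"
    proof -
      have "((u \<otimes>\<^sub>O p) \<otimes>\<^sub>O u) \<otimes>\<^sub>O (ocnj u \<otimes>\<^sub>O q) = u \<otimes>\<^sub>O (p \<otimes>\<^sub>O q)" for p q
        by (simp add: moufang_left unit_phase[OF u(2)])
      then show ?thesis
        by (simp add: F J ijk(2-4) U omul.scaleR_right omul.add_right)
    qed
    have jk: "F (x \<star> y) $ j $ k = (F x \<star> F y) $ j $ k"
    proof -
      have "(p \<otimes>\<^sub>O ocnj u) \<otimes>\<^sub>O ((u \<otimes>\<^sub>O q) \<otimes>\<^sub>O u) = (p \<otimes>\<^sub>O q) \<otimes>\<^sub>O u" for p q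
        by (simp add: moufang_right unit_phase[OF u(2)])
      then show ?thesis
        by (simp add: F J ijk(2-4) U omul.scaleR_left omul.add_left)
    qed
    have ik: "F (x \<star> y) $ i $ k = (F x \<star> F y) $ i $ k"
      by (simp add: F J ijk(2-4) U moufang_middle omul.scaleR_right omul.add_right omul.scaleR_left omul.add_left)
    have flip: "F (x \<star> y) $ b $ a = (F x \<star> F y) $ b $ a" if "F (x \<star> y) $ a $ b = (F x \<star> F y) $ a $ b" for a b
      using that HermD(2)[OF herm[OF jordan_Herm[OF x y]], of a b]
        HermD(2)[OF jordan_Herm[OF herm[OF x] herm[OF y]], of a b] by metis
    have diag: "F (x \<star> y) $ c $ c = (F x \<star> F y) $ c $ c" for c
      by (simp add: F jordan_nth_diag[OF x y] jordan_nth_diag[OF herm[OF x] herm[OF y]] inner_F)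
    show ?thesis
      unfolding vec_eq_iff
      by (rule all[where Q = "\<lambda>a b. F (x \<star> y) $ a $ b = (F x \<star> F y) $ a $ b"])
         (auto intro: ij jk ik flip diag)
  qed
  have "norm (F z) = norm z" for z
    by (rule norm_entrywise) (rule norm_F)
  then show "jordan_isometry K (triality_phase u i j k)"
    unfolding F_def[symmetric] jordan_isometry_def using lin herm hom by blast
  show "norm (triality_phase u i j k x $ a $ b) = norm (x $ a $ b)"
    using norm_F unfolding F_def .
qed

text \<open>
With \<open>u\<close> the conjugate of \<open>q\<close> divided by its norm, both kinds of phase map multiply the \<open>(i, j)\<close> entry by
\<open>u\<close> from the left, which turns \<open>q\<close> into its norm.
\<close>
lemma (in hurwitz_subalgebra) make_entry_real:
  fixes i j :: "'n::finite"
  assumes K: "assoc_on K \<or> CARD('n) = 3" and ij: "i \<noteq> j" and q: "q \<in> K"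
  shows "\<exists>F :: octonion^'n^'n \<Rightarrow> octonion^'n^'n. jordan_isometry K F
    \<and> (\<forall>x\<in>Herm K. \<forall>a. F x $ a $ a = x $ a $ a)
    \<and> (\<forall>x a b. norm (F x $ a $ b) = norm (x $ a $ b))
    \<and> (\<forall>x. x $ i $ j = q \<longrightarrow> F x $ i $ j = oct_of_real (norm q))"
proof (cases "q = 0")
  case True
  then show ?thesis
    by (intro exI[of _ "\<lambda>x. x"]) (simp add: jordan_isometry_id oct_of_real_scaleR[of 0])
next
  case False
  define u where "u = (1 / norm q) *\<^sub>R ocnj q"
  have u: "u \<in> K" "norm u = 1"
    using False q cnj subspace_scale[OF subspace] by (auto simp: u_def)
  have uq: "u \<otimes>\<^sub>O q = oct_of_real (norm q)"
  proof -
    have "ocnj q \<otimes>\<^sub>O q = (norm q * norm q) *\<^sub>R oct_of_real 1"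
      using oct_mult_cnj[of "ocnj q"] by (simp add: power2_eq_square flip: oct_of_real_scaleR)
    then show ?thesis
      using False by (simp add: u_def omul.scaleR_left oct_of_real_scaleR[of "norm q"])
  qed
  from K show ?thesis
  proof
    assume A: "assoc_on K"
    define d where "d a = (if a = i then u else oct_of_real 1)" for a
    have d: "d a \<in> K" "norm (d a) = 1" for a
      using u one by (auto simp: d_def)
    have "diag_phase d x $ a $ a = x $ a $ a" if x: "x \<in> Herm K" for x a
    proof -
      obtain r where r: "x $ a $ a = oct_of_real r" using HermD(3)[OF x] by blast
      show ?thesis
        using d(2)[of a] by (simp add: diag_phase_def r omul.scaleR_left oct_mult_cnj flip: oct_of_real_scaleR)
    qed
    moreover have "diag_phase d x $ i $ j = oct_of_real (norm q)" if "x $ i $ j = q" for x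
      using ij uq that oct_of_real_hom(2)[of 1] by (simp add: diag_phase_def d_def)
    ultimately show ?thesis
      using jordan_isometry_diag_phase[OF A, of d] d
      by (intro exI[of _ "diag_phase d"]) (simp add: diag_phase_def norm_omul)
  next
    assume "CARD('n) = 3"
    then have "card (UNIV - {i, j}) = 1"
      using ij by (simp add: card_Diff_subset)
    then obtain k where k: "UNIV - {i, j} = {k}"
      by (auto simp: card_1_singleton_iff)
    then have ijk: "UNIV = {i, j, k}" "i \<noteq> k" "j \<noteq> k" by auto
    let ?F = "triality_phase u i j k"
    note iso = jordan_isometry_triality_phase[OF u ijk(1) ij ijk(2,3)]
    have "?F x $ a $ a = x $ a $ a" for x a
      using ij ijk(2,3) by (auto simp: triality_phase_def)
    moreover have "?F x $ i $ j = oct_of_real (norm q)" if "x $ i $ j = q" for x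
      using that uq by (simp add: triality_phase_def)
    ultimately show ?thesis
      using iso by (intro exI[of _ ?F]) simp
  qed
qed

section \<open>Diagonalization\<close>

definition plane_reflection :: "real \<Rightarrow> real \<Rightarrow> 'n \<Rightarrow> 'n \<Rightarrow> real^'n^'n"
  where "plane_reflection C S i j = (\<chi> a b.
    if a = i then (if b = i then C else if b = j then S else 0)
    else if a = j then (if b = i then S else if b = j then - C else 0)
    else if a = b then 1 else 0)"

lemma sum_plane_reflection:
  fixes f :: "'n::finite \<Rightarrow> 'v::real_vector"
  assumes "i \<noteq> j"
  shows "(\<Sum>m\<in>UNIV. plane_reflection C S i j $ a $ m *\<^sub>R f m) =
    (if a = i then C *\<^sub>R f i + S *\<^sub>R f j else if a = j then S *\<^sub>R f i - C *\<^sub>R f j else f a)"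
proof -
  have two: "(\<Sum>m\<in>UNIV. (if m = i then p else if m = j then q else 0) *\<^sub>R f m) = p *\<^sub>R f i + q *\<^sub>R f j" for p q
  proof -
    have "(\<Sum>m\<in>UNIV. (if m = i then p else if m = j then q else 0) *\<^sub>R f m)
        = (\<Sum>m\<in>UNIV. (if m = i then p *\<^sub>R f i else 0) + (if m = j then q *\<^sub>R f j else 0))"
      using assms by (intro sum.cong) auto
    then show ?thesis by (simp add: sum.distrib)
  qed
  have "(\<Sum>m\<in>UNIV. (if a = m then 1 else 0) *\<^sub>R f m) = (\<Sum>m\<in>UNIV. if a = m then f m else 0)"
    by (intro sum.cong) auto
  then show ?thesis
    using assms two[of C S] two[of S "- C"] by (simp add: plane_reflection_def)
qed

lemma orthogonal_plane_reflection:
  fixes i j :: "'n::finite"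
  assumes ij: "i \<noteq> j" and CS: "C\<^sup>2 + S\<^sup>2 = 1"
  shows "orthogonal_matrix (plane_reflection C S i j)"
proof -
  let ?Q = "plane_reflection C S i j"
  have CS': "C * C + S * S = 1" "S * S + C * C = 1"
    using CS by (simp_all add: power2_eq_square add.commute)
  have sym: "transpose ?Q = ?Q"
    using ij by (auto simp: transpose_def vec_eq_iff plane_reflection_def)
  have "(?Q ** ?Q) $ a $ b = mat 1 $ a $ b" for a b
  proof -
    have "(?Q ** ?Q) $ a $ b = (\<Sum>m\<in>UNIV. ?Q $ a $ m *\<^sub>R ?Q $ m $ b)"
      by (simp add: matrix_matrix_mult_def)
    also have "\<dots> = mat 1 $ a $ b"
      unfolding sum_plane_reflection[OF ij]
      using ij CS' by (auto simp: plane_reflection_def mat_def mult.commute)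
    finally show ?thesis .
  qed
  then have "?Q ** ?Q = mat 1" by (simp add: vec_eq_iff)
  then show ?thesis by (simp add: orthogonal_matrix_def sym)
qed

lemma oRe_linear: "oRe (a + b) = oRe a + oRe b" "oRe (a - b) = oRe a - oRe b" "oRe (c *\<^sub>R a) = c * oRe a"
  by (simp_all add: oRe_inner inner_add_left inner_diff_left)

lemma real_conj_plane_diag:
  assumes ij: "i \<noteq> j" and r: "oRe (w $ i $ j) = r" "oRe (w $ j $ i) = r"
  shows "oRe (real_conj (plane_reflection C S i j) w $ a $ a) =
    (if a = i then C\<^sup>2 * oRe (w $ i $ i) + 2 * C * S * r + S\<^sup>2 * oRe (w $ j $ j)
     else if a = j then S\<^sup>2 * oRe (w $ i $ i) - 2 * C * S * r + C\<^sup>2 * oRe (w $ j $ j)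
     else oRe (w $ a $ a))"
  unfolding real_conj_nth sum_plane_reflection[OF ij]
  using ij by (auto simp: oRe_linear r power2_eq_square algebra_simps)

definition diag_size :: "octonion^'n^'n \<Rightarrow> real"
  where "diag_size x = (\<Sum>a\<in>UNIV. (oRe (x $ a $ a))\<^sup>2)"

text \<open>
Once the entry is a real number \<open>r\<close>, the block at \<open>i\<close> and \<open>j\<close> is a real symmetric \<open>2 \<times> 2\<close> matrix with
diagonal \<open>(p, q)\<close>. A reflection keeps \<open>p + q\<close> and, at the right angle, replaces \<open>p - q\<close> by the difference
\<open>R\<close> of the eigenvalues, which is larger in absolute value because \<open>r\<close> is nonzero.
\<close>
lemma (in hurwitz_subalgebra) diag_size_increase:
  fixes z :: "octonion^'n^'n"
  assumes K: "assoc_on K \<or> CARD('n) = 3" and z: "z \<in> Herm K" and ij: "i \<noteq> j" and nz: "z $ i $ j \<noteq> 0"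
  shows "\<exists>G. jordan_isometry K G \<and> diag_size z < diag_size (G z)"
proof -
  define r where "r = norm (z $ i $ j)"
  have r: "r > 0" using nz by (simp add: r_def)
  obtain P where P: "jordan_isometry K P" "\<And>a. P z $ a $ a = z $ a $ a" "P z $ i $ j = oct_of_real r"
    using make_entry_real[OF K ij HermD(1)[OF z, of i j]] z unfolding r_def by blast
  define w where "w = P z"
  have w: "w \<in> Herm K" using jordan_isometryD(3)[OF P(1) z] by (simp add: w_def)
  have wij: "oRe (w $ i $ j) = r" "oRe (w $ j $ i) = r"
  proof -
    have "w $ i $ j = oct_of_real r" "w $ j $ i = oct_of_real r"
      using P(3) HermD(2)[OF w, of i j] oct_of_real_hom(2)[of r] by (simp_all add: w_def)
    then show "oRe (w $ i $ j) = r" "oRe (w $ j $ i) = r" by simp_all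
  qed
  define p where "p = oRe (z $ i $ i)"
  define q where "q = oRe (z $ j $ j)"
  define R where "R = sqrt ((p - q)\<^sup>2 + (2 * r)\<^sup>2)"
  have R2: "R\<^sup>2 = (p - q)\<^sup>2 + (2 * r)\<^sup>2" by (simp add: R_def)
  have R: "R > 0" unfolding R_def using r by (simp add: add_nonneg_pos)
  have "((p - q) / R)\<^sup>2 + (2 * r / R)\<^sup>2 = R\<^sup>2 / R\<^sup>2"
    by (simp only: R2 power_divide add_divide_distrib)
  then have "((p - q) / R)\<^sup>2 + (2 * r / R)\<^sup>2 = 1"
    using R by simp
  then obtain t where t: "(p - q) / R = cos t" "2 * r / R = sin t"
    using sincos_total_2pi by metis
  \<comment> \<open>the half angle, so that the double angle formulas give the direction of \<open>(p - q, 2 r)\<close>\<close>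
  define C where "C = cos (t / 2)"
  define S where "S = sin (t / 2)"
  have CS: "C\<^sup>2 + S\<^sup>2 = 1" by (simp add: C_def S_def)
  have ct: "C\<^sup>2 - S\<^sup>2 = (p - q) / R" and st: "2 * C * S = 2 * r / R"
    using t cos_double[of "t / 2"] sin_double[of "t / 2"] by (simp_all add: C_def S_def)
  let ?Q = "plane_reflection C S i j"
  define p' where "p' = C\<^sup>2 * p + 2 * C * S * r + S\<^sup>2 * q"
  define q' where "q' = S\<^sup>2 * p - 2 * C * S * r + C\<^sup>2 * q"
  have "p' + q' = (C\<^sup>2 + S\<^sup>2) * (p + q)" by (simp add: p'_def q'_def algebra_simps)
  then have sum: "p' + q' = p + q" by (simp add: CS)
  have "p' - q' = (C\<^sup>2 - S\<^sup>2) * (p - q) + 2 * (2 * C * S) * r" by (simp add: p'_def q'_def algebra_simps)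
  also have "\<dots> = R\<^sup>2 / R" unfolding ct st R2 by (simp add: add_divide_distrib power2_eq_square)
  finally have diff: "p' - q' = R" using R by (simp add: power2_eq_square)
  have "2 * (p'\<^sup>2 + q'\<^sup>2) = (p' + q')\<^sup>2 + (p' - q')\<^sup>2" by (simp add: power2_eq_square algebra_simps)
  also have "\<dots> = 2 * (p\<^sup>2 + q\<^sup>2) + (2 * r)\<^sup>2" unfolding sum diff R2 by (simp add: power2_eq_square algebra_simps)
  finally have "2 * (p'\<^sup>2 + q'\<^sup>2) = 2 * (p\<^sup>2 + q\<^sup>2) + (2 * r)\<^sup>2" .
  moreover have "0 < (2 * r)\<^sup>2" using r by simp
  moreover have "B < A" if "2 * A = 2 * B + e" "0 < e" for A B e :: real using that by simp
  ultimately have gain: "p\<^sup>2 + q\<^sup>2 < p'\<^sup>2 + q'\<^sup>2" by blast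
  have split: "(\<Sum>a\<in>UNIV. g a) = g i + (g j + (\<Sum>a\<in>UNIV - {i} - {j}. g a))" for g :: "'n \<Rightarrow> real"
    using ij sum.remove[of UNIV i g] sum.remove[of "UNIV - {i}" j g] by simp
  have d: "oRe (real_conj ?Q w $ a $ a) = (if a = i then p' else if a = j then q' else oRe (z $ a $ a))" for a
    using real_conj_plane_diag[OF ij wij, of C S a] by (simp add: P(2) w_def p_def q_def p'_def q'_def)
  have "diag_size z < diag_size (real_conj ?Q w)"
    unfolding diag_size_def split d using ij gain by (simp add: p_def q_def)
  then show ?thesis
    using jordan_isometry_compose[OF jordan_isometry_real_conj[OF orthogonal_plane_reflection[OF ij CS]] P(1)]
    unfolding w_def by blast
qed

text \<open>
Bounded linear maps between Euclidean spaces form a space with the Heine-Borel property, and all the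
defining conditions are closed.
\<close>
lemma (in hurwitz_subalgebra) compact_jordan_isometries:
  "compact {B :: (octonion^'n^'n) \<Rightarrow>\<^sub>L (octonion^'n^'n). jordan_isometry K (blinfun_apply B)}"
proof -
  let ?S = "{B :: (octonion^'n^'n) \<Rightarrow>\<^sub>L (octonion^'n^'n). jordan_isometry K (blinfun_apply B)}"
  have "norm B \<le> 1" if "B \<in> ?S" for B
    using that by (intro norm_blinfun_bound) (auto simp: jordan_isometry_def)
  then have "bounded ?S" by (auto simp: bounded_iff)
  moreover have "closed ?S"
  proof -
    have eq: "?S = (\<Inter>z. {B. norm (blinfun_apply B z) = norm z})
        \<inter> (\<Inter>x\<in>Herm K. {B. blinfun_apply B x \<in> Herm K})
        \<inter> (\<Inter>x\<in>Herm K. \<Inter>y\<in>Herm K. {B. blinfun_apply B (x \<star> y) = blinfun_apply B x \<star> blinfun_apply B y})"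
      by (auto simp: jordan_isometry_def blinfun.bounded_linear_right bounded_linear.linear)
    have [continuous_intros]: "continuous_on UNIV (\<lambda>B. blinfun_apply B z)" for z :: "octonion^'n^'n"
      by (intro linear_continuous_on blinfun.bounded_linear_left)
    have "closed {B :: (octonion^'n^'n) \<Rightarrow>\<^sub>L (octonion^'n^'n). norm (B z) = norm z}" for z
      by (intro closed_Collect_eq continuous_intros)
    moreover have "closed {B :: (octonion^'n^'n) \<Rightarrow>\<^sub>L (octonion^'n^'n). B x \<in> Herm K}" for x
      using continuous_closed_vimage[OF closed_subspace[OF subspace_Herm], of "\<lambda>B. blinfun_apply B x"]
      by (auto simp: vimage_def intro!: linear_continuous_at blinfun.bounded_linear_left)
    moreover have "closed {B :: (octonion^'n^'n) \<Rightarrow>\<^sub>L (octonion^'n^'n). B (x \<star> y) = B x \<star> B y}" for x y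
      by (intro closed_Collect_eq jordan.continuous_on continuous_intros)
    ultimately show ?thesis
      unfolding eq by (intro closed_Int closed_INT ballI)
  qed
  ultimately show ?thesis by (simp add: compact_eq_bounded_closed)
qed

theorem (in hurwitz_subalgebra) diagonalization:
  fixes x :: "octonion^'n^'n"
  assumes K: "assoc_on K \<or> CARD('n) = 3" and x: "x \<in> Herm K"
  shows "\<exists>F. jordan_isometry K F \<and> (\<forall>i j. i \<noteq> j \<longrightarrow> F x $ i $ j = 0)"
proof -
  let ?S = "{B :: (octonion^'n^'n) \<Rightarrow>\<^sub>L (octonion^'n^'n). jordan_isometry K (blinfun_apply B)}"
  have bl: "\<exists>B\<in>?S. blinfun_apply B = F" if "jordan_isometry K F" for F
    using that bounded_linear_Blinfun_apply[of F] jordan_isometryD(1)[OF that]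
    by (intro bexI[of _ "Blinfun F"]) (simp_all add: linear_conv_bounded_linear)
  have ne: "?S \<noteq> {}" using bl[OF jordan_isometry_id] by blast
  have cont: "continuous_on ?S (\<lambda>B. diag_size (B x))"
  proof -
    have "continuous_on ?S (\<lambda>B. blinfun_apply B x)"
      by (intro linear_continuous_on blinfun.bounded_linear_left)
    then show ?thesis
      unfolding diag_size_def oRe_inner by (intro continuous_intros)
  qed
  obtain B where B: "B \<in> ?S" "\<And>B'. B' \<in> ?S \<Longrightarrow> diag_size (B' x) \<le> diag_size (B x)"
    using continuous_attains_sup[OF compact_jordan_isometries ne cont] by blast
  then have BF: "jordan_isometry K (blinfun_apply B)" by simp
  have "B x $ i $ j = 0" if ij: "i \<noteq> j" for i j
  proof (rule ccontr)
    assume "B x $ i $ j \<noteq> 0"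
    then obtain G where G: "jordan_isometry K G" "diag_size (B x) < diag_size (G (B x))"
      using diag_size_increase[OF K jordan_isometryD(3)[OF BF x] ij] by blast
    obtain B' where "B' \<in> ?S" "blinfun_apply B' = (\<lambda>x. G (B x))"
      using bl[OF jordan_isometry_compose[OF G(1) BF]] by blast
    then show False using B(2)[of B'] G(2) by simp
  qed
  then show ?thesis using BF by blast
qed

section \<open>Sectional nonassociativity and commutators\<close>

text \<open>
The numerator of the nonassociativity, with the Euclidean inner product in place of \<open>hhat\<close>.
\<close>
definition nonassoc_num :: "octonion^'n^'n \<Rightarrow> octonion^'n^'n \<Rightarrow> real"
  where "nonassoc_num x y = (x \<star> x) \<bullet> (y \<star> y) - (x \<star> y) \<bullet> (x \<star> y)"

definition gram :: "'a::real_inner \<Rightarrow> 'a \<Rightarrow> real"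
  where "gram x y = (x \<bullet> x) * (y \<bullet> y) - (x \<bullet> y)\<^sup>2"

lemma lin_indep_iff: "lin_indep x y \<longleftrightarrow> x \<noteq> 0 \<and> (\<forall>c. y \<noteq> c *\<^sub>R x)"
proof -
  have "lin_indep x y \<longleftrightarrow> x \<noteq> y \<and> x \<noteq> 0 \<and> y \<notin> span {x}"
    using independent_insert[of y "{x}"] by (auto simp: lin_indep_def insert_commute)
  also have "\<dots> \<longleftrightarrow> x \<noteq> 0 \<and> (\<forall>c. y \<noteq> c *\<^sub>R x)"
    by (auto simp: span_singleton) (metis scaleR_one)
  finally show ?thesis .
qed

lemma gram_pos:
  assumes "lin_indep x y"
  shows "0 < gram x y"
proof -
  have x: "x \<noteq> 0" and y: "\<And>c. y \<noteq> c *\<^sub>R x" using assms by (auto simp: lin_indep_iff)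
  define w where "w = y - ((x \<bullet> y) / (x \<bullet> x)) *\<^sub>R x"
  have "w \<noteq> 0" using y[of "(x \<bullet> y) / (x \<bullet> x)"] by (simp add: w_def)
  then have "0 < (x \<bullet> x) * (w \<bullet> w)" using x by simp
  also have "\<dots> = gram x y"
    using x by (simp add: w_def gram_def inner_diff_left inner_diff_right inner_commute field_simps power2_eq_square)
  finally show ?thesis .
qed

lemma (in hurwitz_subalgebra) sect_nonassoc_eq:
  fixes x y :: "octonion^'n^'n"
  assumes x: "x \<in> Herm K" and y: "y \<in> Herm K"
  shows "sect_nonassoc K x y = real CARD('n) * nonassoc_num x y / gram x y"
proof -
  define n where "n = real CARD('n)"
  have n: "n \<noteq> 0" by (simp add: n_def)
  have "sect_nonassoc K x y = (nonassoc_num x y / n) / (gram x y / n\<^sup>2)"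
    unfolding sect_nonassoc_def hhat_inner[OF x x] hhat_inner[OF y y] hhat_inner[OF x y]
      hhat_inner[OF jordan_Herm[OF x x] jordan_Herm[OF y y]] hhat_inner[OF jordan_Herm[OF x y] jordan_Herm[OF x y]]
      nonassoc_num_def gram_def n_def[symmetric]
    by (simp add: diff_divide_distrib power_divide power2_eq_square)
  also have "\<dots> = n * nonassoc_num x y / gram x y"
    using n by (simp add: power2_eq_square)
  finally show ?thesis by (simp add: n_def)
qed

lemma jordan_isometry_invariants:
  assumes F: "jordan_isometry K F" and xy: "x \<in> Herm K" "y \<in> Herm K"
  shows "nonassoc_num (F x) (F y) = nonassoc_num x y" "gram (F x) (F y) = gram x y"
  using xy jordan_isometryD(4)[OF F, symmetric] jordan_isometryD(5)[OF F]
  by (simp_all add: nonassoc_num_def gram_def)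

lemma mmul_assoc:
  assumes assoc: "assoc_on K"
    and K: "\<And>i j. a $ i $ j \<in> K" "\<And>i j. b $ i $ j \<in> K" "\<And>i j. c $ i $ j \<in> K"
  shows "mmul (mmul a b) c = mmul a (mmul b c)"
proof -
  have "(\<Sum>l\<in>UNIV. \<Sum>m\<in>UNIV. (a $ i $ m \<otimes>\<^sub>O b $ m $ l) \<otimes>\<^sub>O c $ l $ j)
      = (\<Sum>m\<in>UNIV. \<Sum>l\<in>UNIV. a $ i $ m \<otimes>\<^sub>O (b $ m $ l \<otimes>\<^sub>O c $ l $ j))" for i j
    using assoc K by (subst sum.swap) (simp add: assoc_on_def)
  then show ?thesis
    by (simp add: vec_eq_iff mmul_nth omul.sum_left omul.sum_right)
qed

text \<open>
Put \<open>p = x y\<close> and \<open>q = y x\<close>. Associativity and cyclicity give \<open>tr (x\<^sup>2 y\<^sup>2) = tr (p q)\<close>, so the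
numerator is \<open>tr (p q) - tr ((p + q)\<^sup>2) / 4 = - tr ((p - q)\<^sup>2) / 4\<close>. As \<open>q\<close> is the conjugate transpose of
\<open>p\<close>, the difference \<open>p - q\<close> is anti-Hermitian, and minus the trace of its square is its squared norm.
\<close>
lemma (in hurwitz_subalgebra) nonassoc_num_commutator:
  fixes x y :: "octonion^'n^'n"
  assumes assoc: "assoc_on K" and x: "x \<in> Herm K" and y: "y \<in> Herm K"
  shows "nonassoc_num x y = (norm (mmul x y - mmul y x))\<^sup>2 / 4"
proof -
  define p where "p = mmul x y"
  define q where "q = mmul y x"
  note as = mmul_assoc[OF assoc]
  note xK = HermD(1)[OF x] and yK = HermD(1)[OF y]
  have mK: "mmul a b $ i $ j \<in> K" if "\<And>i j. a $ i $ j \<in> K" "\<And>i j. b $ i $ j \<in> K" for a b :: "octonion^'n^'n" and i j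
    unfolding mmul_nth by (intro subspace_sum subspace mult that)
  have tr_pq: "mat_trace (mmul p q) = (x \<star> x) \<bullet> (y \<star> y)"
  proof -
    have "mmul p q = mmul x (mmul (mmul y y) x)"
      unfolding p_def q_def by (simp add: as xK yK mK)
    then have "mat_trace (mmul p q) = mat_trace (mmul (mmul (mmul y y) x) x)"
      by (simp add: mat_trace_mmul_commute[of x])
    also have "\<dots> = mat_trace (mmul (mmul y y) (mmul x x))"
      by (simp add: as xK yK mK)
    also have "\<dots> = mat_trace (mmul (mmul x x) (mmul y y))"
      by (rule mat_trace_mmul_commute)
    also have "\<dots> = mat_trace ((x \<star> x) \<star> (y \<star> y))"
      by (simp add: mat_trace_jordan) (simp add: jordan_def)
    finally show ?thesis
      by (simp add: mat_trace_jordan_Herm[OF jordan_Herm[OF y y]])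
  qed
  have "(x \<star> y) \<bullet> (x \<star> y) = mat_trace (mmul (x \<star> y) (x \<star> y))"
    by (simp add: mat_trace_jordan flip: mat_trace_jordan_Herm[OF jordan_Herm[OF x y]])
  also have "\<dots> = (mat_trace (mmul p p) + 2 * mat_trace (mmul p q) + mat_trace (mmul q q)) / 4"
    by (simp add: jordan_def mmul_scaleR mmul_add mat_trace_linear mat_trace_mmul_commute[of q p] add_divide_distrib distrib_left flip: p_def q_def)
  finally have anti: "(x \<star> y) \<bullet> (x \<star> y) = (mat_trace (mmul p p) + 2 * mat_trace (mmul p q) + mat_trace (mmul q q)) / 4" .
  have c: "ocnj (p $ j $ i) = q $ i $ j" for i j
    by (simp add: p_def q_def mmul_nth linear_sum[OF linear_ocnj] ocnj_omul HermD(2)[OF x] HermD(2)[OF y])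
  then have c': "ocnj (q $ j $ i) = p $ i $ j" for i j
    by (metis ocnj_ocnj)
  have "mat_trace (mmul (p - q) (p - q)) = - ((p - q) \<bullet> (p - q))"
    by (simp add: mat_trace_mmul inner_vec_def linear_diff[OF linear_ocnj] c c' inner_diff_right flip: sum_negf)
  moreover have "mmul (p - q) (p - q) = mmul p p - mmul p q - mmul q p + mmul q q"
    using mmul_add(1)[of p "(-1) *\<^sub>R q"] mmul_add(2)[of _ p "(-1) *\<^sub>R q"]
    by (simp add: mmul_scaleR(1)[of "-1", simplified] mmul_scaleR(2)[of _ "-1", simplified])
  ultimately have "(norm (p - q))\<^sup>2 = 2 * mat_trace (mmul p q) - mat_trace (mmul p p) - mat_trace (mmul q q)"
    by (simp add: power2_norm_eq_inner mat_trace_linear mat_trace_mmul_commute[of q p])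
  then show ?thesis
    using tr_pq anti by (simp add: nonassoc_num_def p_def q_def field_simps)
qed

section \<open>The bounds in a diagonal frame\<close>

locale diagonal_pair =
  fixes K :: "octonion set" and x z :: "octonion^'n^'n"
  assumes x: "x \<in> Herm K" and z: "z \<in> Herm K" and diag: "\<And>i j. i \<noteq> j \<Longrightarrow> x $ i $ j = 0"
begin

text \<open>
The diagonals of \<open>x\<close> and \<open>z\<close> are \<open>l\<close> and \<open>\<zeta>\<close>, and \<open>S\<close> is the squared norm of \<open>x\<close>. The projection of \<open>z\<close> to
the line spanned by \<open>x\<close> is \<open>t\<close> times \<open>x\<close>.
\<close>
definition l :: "'n \<Rightarrow> real" where "l i = oRe (x $ i $ i)"
definition \<zeta> :: "'n \<Rightarrow> real" where "\<zeta> i = oRe (z $ i $ i)"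
definition off :: "'n \<Rightarrow> 'n \<Rightarrow> real" where "off i j = (if i = j then 0 else (norm (z $ i $ j))\<^sup>2)"
definition S :: real where "S = (\<Sum>i\<in>UNIV. (l i)\<^sup>2)"
definition t :: real where "t = (\<Sum>i\<in>UNIV. l i * \<zeta> i) / S"

lemma x_nth: "x $ i $ j = (if i = j then l i *\<^sub>R oct_of_real 1 else 0)"
proof (cases "i = j")
  case True
  have "x $ i $ i = l i *\<^sub>R oct_of_real 1"
    unfolding l_def by (rule trans[OF HermD(3)[OF x] oct_of_real_scaleR])
  then show ?thesis using True by simp
qed (simp add: diag)

lemma z_diag: "z $ i $ i = \<zeta> i *\<^sub>R oct_of_real 1"
  unfolding \<zeta>_def by (rule trans[OF HermD(3)[OF z] oct_of_real_scaleR])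

lemma one_inner_one: "oct_of_real 1 \<bullet> oct_of_real 1 = 1"
  by (simp add: dot_square_norm)

lemma jordan_x_nth: "(x \<star> w) $ i $ j = ((l i + l j) / 2) *\<^sub>R w $ i $ j"
proof -
  have "x $ i $ m \<otimes>\<^sub>O w $ m $ j = (if i = m then l i *\<^sub>R w $ i $ j else 0)"
    "w $ i $ m \<otimes>\<^sub>O x $ m $ j = (if m = j then l j *\<^sub>R w $ i $ j else 0)" for m
    by (auto simp: x_nth omul.scaleR_left omul.scaleR_right)
  then show ?thesis
    by (simp add: jordan_nth sum.distrib scaleR_add_left scaleR_add_right add_divide_distrib)
qed

text \<open>
The two mixed terms of \<open>\<langle>x \<star> x, z \<star> z\<rangle>\<close> are symmetrized over \<open>(i, j)\<close> and \<open>(j, i)\<close>, where \<open>z\<close> has entries of equal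
norm; what remains is the identity \<open>(a\<^sup>2 + b\<^sup>2) / 2 - ((a + b) / 2)\<^sup>2 = (a - b)\<^sup>2 / 4\<close>.
\<close>
lemma nonassoc_num_diag: "nonassoc_num x z = (\<Sum>i\<in>UNIV. \<Sum>j\<in>UNIV. (l i - l j)\<^sup>2 / 4 * off i j)"
proof -
  let ?N = "\<lambda>i j. (norm (z $ i $ j))\<^sup>2"
  have "(x \<star> x) \<bullet> (z \<star> z) = (\<Sum>i\<in>UNIV. (l i)\<^sup>2 * (\<Sum>j\<in>UNIV. ?N i j))"
    unfolding inner_vec_def
  proof (intro sum.cong refl)
    fix i
    have N: "(\<Sum>j\<in>UNIV. z $ k $ j \<bullet> z $ k $ j) = (\<Sum>j\<in>UNIV. ?N k j)" for k
      by (simp add: power2_norm_eq_inner)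
    have "(x \<star> x) $ i $ j \<bullet> (z \<star> z) $ i $ j = (if i = j then (l i)\<^sup>2 * (\<Sum>j\<in>UNIV. ?N i j) else 0)" for j
      by (simp add: jordan_x_nth x_nth jordan_nth_diag[OF z z] oct_of_real_scaleR[of "sum _ _"] N
          one_inner_one power2_eq_square)
    then show "(\<Sum>j\<in>UNIV. (x \<star> x) $ i $ j \<bullet> (z \<star> z) $ i $ j) = (l i)\<^sup>2 * (\<Sum>j\<in>UNIV. ?N i j)"
      by simp
  qed
  also have "\<dots> = (\<Sum>i\<in>UNIV. \<Sum>j\<in>UNIV. (l i)\<^sup>2 * ?N i j)"
    by (simp add: sum_distrib_left)
  finally have a: "(x \<star> x) \<bullet> (z \<star> z) = (\<Sum>i\<in>UNIV. \<Sum>j\<in>UNIV. (l i)\<^sup>2 * ?N i j)" .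
  then have b: "(x \<star> x) \<bullet> (z \<star> z) = (\<Sum>i\<in>UNIV. \<Sum>j\<in>UNIV. (l j)\<^sup>2 * ?N i j)"
    by (subst sum.swap) (simp add: HermD(4)[OF z])
  have "(x \<star> z) \<bullet> (x \<star> z) = (\<Sum>i\<in>UNIV. \<Sum>j\<in>UNIV. ((l i + l j) / 2)\<^sup>2 * ?N i j)"
  proof -
    have "(c *\<^sub>R w) \<bullet> (c *\<^sub>R w) = c\<^sup>2 * (norm w)\<^sup>2" for c and w :: octonion
      unfolding power2_norm_eq_inner by (simp add: power2_eq_square)
    then show ?thesis unfolding inner_vec_def jordan_x_nth by (intro sum.cong refl)
  qed
  then have "nonassoc_num x z = (\<Sum>i\<in>UNIV. \<Sum>j\<in>UNIV. ((l i)\<^sup>2 * ?N i j + (l j)\<^sup>2 * ?N i j) / 2 - ((l i + l j) / 2)\<^sup>2 * ?N i j)"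
    using a b by (simp add: nonassoc_num_def sum_subtractf sum.distrib add_divide_distrib flip: sum_divide_distrib)
  also have "\<dots> = (\<Sum>i\<in>UNIV. \<Sum>j\<in>UNIV. (l i - l j)\<^sup>2 / 4 * off i j)"
    by (intro sum.cong refl) (simp add: off_def power2_eq_square field_simps)
  finally show ?thesis .
qed

lemma gram_diag:
  assumes "S \<noteq> 0"
  shows "gram x z = S * (\<Sum>i\<in>UNIV. (\<zeta> i - t * l i)\<^sup>2) + (\<Sum>i\<in>UNIV. \<Sum>j\<in>UNIV. S * off i j)"
proof -
  have xx: "x \<bullet> x = S"
  proof -
    have "x $ i $ j \<bullet> x $ i $ j = (if i = j then (l i)\<^sup>2 else 0)" for i j
      by (simp add: x_nth one_inner_one power2_eq_square)
    then show ?thesis by (simp add: inner_vec_def S_def)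
  qed
  have xz: "x \<bullet> z = (\<Sum>i\<in>UNIV. l i * \<zeta> i)"
  proof -
    have "x $ i $ j \<bullet> z $ i $ j = (if i = j then l i * \<zeta> i else 0)" for i j
      by (simp add: x_nth z_diag one_inner_one)
    then show ?thesis by (simp add: inner_vec_def)
  qed
  have zz: "z \<bullet> z = (\<Sum>i\<in>UNIV. (\<zeta> i)\<^sup>2) + (\<Sum>i\<in>UNIV. \<Sum>j\<in>UNIV. off i j)"
  proof -
    have "z $ i $ j \<bullet> z $ i $ j = (if i = j then (\<zeta> i)\<^sup>2 else 0) + off i j" for i j
      by (simp add: off_def z_diag one_inner_one power2_eq_square flip: power2_norm_eq_inner)
    then show ?thesis by (simp add: inner_vec_def sum.distrib)
  qed
  have "(\<Sum>i\<in>UNIV. (\<zeta> i - t * l i)\<^sup>2) = (\<Sum>i\<in>UNIV. (\<zeta> i)\<^sup>2 - 2 * t * (l i * \<zeta> i) + t\<^sup>2 * (l i)\<^sup>2)"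
    by (intro sum.cong refl) (simp add: power2_eq_square algebra_simps)
  also have "\<dots> = (\<Sum>i\<in>UNIV. (\<zeta> i)\<^sup>2) - 2 * t * (\<Sum>i\<in>UNIV. l i * \<zeta> i) + t\<^sup>2 * S"
    by (simp add: sum.distrib sum_subtractf S_def sum_distrib_left)
  finally have "S * (\<Sum>i\<in>UNIV. (\<zeta> i - t * l i)\<^sup>2) = S * (\<Sum>i\<in>UNIV. (\<zeta> i)\<^sup>2) - (\<Sum>i\<in>UNIV. l i * \<zeta> i)\<^sup>2"
    using assms by (simp add: t_def power2_eq_square field_simps)
  then show ?thesis
    by (simp add: gram_def xx xz zz distrib_left sum_distrib_left)
qed

lemma S_bound:
  assumes "i \<noteq> j"
  shows "(l i)\<^sup>2 + (l j)\<^sup>2 + (\<Sum>k\<in>UNIV-{i}-{j}. (l k)\<^sup>2) = S"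
  using assms sum.remove[of UNIV i "\<lambda>k. (l k)\<^sup>2"] sum.remove[of "UNIV - {i}" j "\<lambda>k. (l k)\<^sup>2"]
  by (simp add: S_def)

lemma gap_nonneg: "0 \<le> (S - (l i - l j)\<^sup>2 / 2) * off i j"
proof (cases "i = j")
  case False
  have rest: "0 \<le> (\<Sum>k\<in>UNIV-{i}-{j}. (l k)\<^sup>2)"
    by (rule sum_nonneg) simp
  have "(l i - l j)\<^sup>2 / 2 = (l i)\<^sup>2 + (l j)\<^sup>2 - (l i + l j)\<^sup>2 / 2"
    by (simp add: power2_eq_square field_simps)
  then have "(l i - l j)\<^sup>2 / 2 \<le> S"
    using S_bound[OF False] rest zero_le_power2[of "l i + l j"] by linarith
  then show ?thesis by (simp add: off_def)
qed (simp add: off_def)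

text \<open>
The defect in the upper bound as a sum of nonnegative terms: the defect in the Cauchy-Schwarz inequality
for the two diagonals, and one term for each off-diagonal position.
\<close>
lemma gap:
  assumes "S \<noteq> 0"
  shows "gram x z - 2 * nonassoc_num x z
    = S * (\<Sum>i\<in>UNIV. (\<zeta> i - t * l i)\<^sup>2) + (\<Sum>i\<in>UNIV. \<Sum>j\<in>UNIV. (S - (l i - l j)\<^sup>2 / 2) * off i j)"
proof -
  have "2 * nonassoc_num x z = (\<Sum>i\<in>UNIV. \<Sum>j\<in>UNIV. (l i - l j)\<^sup>2 / 2 * off i j)"
    unfolding nonassoc_num_diag sum_distrib_left by (intro sum.cong refl) simp
  then show ?thesis
    by (simp add: gram_diag[OF assms] left_diff_distrib sum_subtractf)
qed

lemma S_pos: "x \<noteq> 0 \<Longrightarrow> 0 < S"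
proof -
  assume "x \<noteq> 0"
  then obtain i where "l i \<noteq> 0" by (auto simp: vec_eq_iff x_nth split: if_splits)
  then show "0 < S" unfolding S_def by (intro sum_pos2[of _ i]) auto
qed

lemma nonassoc_num_bounds:
  assumes "x \<noteq> 0"
  shows "0 \<le> nonassoc_num x z" "2 * nonassoc_num x z \<le> gram x z"
proof -
  show "0 \<le> nonassoc_num x z"
    unfolding nonassoc_num_diag by (intro sum_nonneg) (simp add: off_def)
  have "0 \<le> gram x z - 2 * nonassoc_num x z"
    using S_pos[OF assms] by (subst gap) (auto intro!: add_nonneg_nonneg mult_nonneg_nonneg sum_nonneg gap_nonneg)
  then show "2 * nonassoc_num x z \<le> gram x z" by simp
qed

text \<open>
All terms of \<open>gap\<close> vanish. The first ones make the diagonal of \<open>z\<close> proportional to that of \<open>x\<close>, so \<open>z\<close> must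
have a nonzero off-diagonal entry. At the position \<open>(a, b)\<close> of any such entry the coefficient
\<open>S - (l a - l b)\<^sup>2 / 2\<close>, which is the sum of \<open>(l a + l b)\<^sup>2 / 2\<close> and the squares of the other eigenvalues, is
zero. Hence \<open>l a\<close> and \<open>l b\<close> are the only nonzero eigenvalues, which determines \<open>{a, b}\<close>.
\<close>
lemma extremal:
  assumes ind: "lin_indep x z" and eq: "2 * nonassoc_num x z = gram x z"
  shows "\<exists>i j. i \<noteq> j \<and> z $ i $ j \<noteq> 0 \<and> l i \<noteq> 0 \<and> l j = - l i
    \<and> (\<forall>a. a \<noteq> i \<longrightarrow> a \<noteq> j \<longrightarrow> l a = 0) \<and> (\<forall>a. \<zeta> a = t * l a)
    \<and> (\<forall>a b. a \<noteq> b \<longrightarrow> z $ a $ b \<noteq> 0 \<longrightarrow> {a, b} = {i, j})"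
proof -
  have "x \<noteq> 0" using ind by (simp add: lin_indep_iff)
  then have S: "S > 0" by (rule S_pos)
  have gap0: "S * (\<Sum>i\<in>UNIV. (\<zeta> i - t * l i)\<^sup>2) + (\<Sum>i\<in>UNIV. \<Sum>j\<in>UNIV. (S - (l i - l j)\<^sup>2 / 2) * off i j) = 0"
    using gap eq S by simp
  have nn: "0 \<le> S * (\<Sum>i\<in>UNIV. (\<zeta> i - t * l i)\<^sup>2)"
    "0 \<le> (\<Sum>i\<in>UNIV. \<Sum>j\<in>UNIV. (S - (l i - l j)\<^sup>2 / 2) * off i j)"
    using S by (auto intro!: mult_nonneg_nonneg sum_nonneg gap_nonneg)
  have "(\<Sum>i\<in>UNIV. (\<zeta> i - t * l i)\<^sup>2) = 0"
    using gap0 nn S by (simp add: add_nonneg_eq_0_iff)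
  then have zeta: "\<zeta> a = t * l a" for a
    by (simp add: sum_nonneg_eq_0_iff)
  have "(\<Sum>i\<in>UNIV. \<Sum>j\<in>UNIV. (S - (l i - l j)\<^sup>2 / 2) * off i j) = 0"
    using gap0 nn by (simp add: add_nonneg_eq_0_iff)
  then have term0: "(S - (l a - l b)\<^sup>2 / 2) * off a b = 0" for a b
    by (simp add: sum_nonneg_eq_0_iff gap_nonneg sum_nonneg del: mult_eq_0_iff)
  have pair: "l b = - l a \<and> l a \<noteq> 0 \<and> (\<forall>c. c \<noteq> a \<longrightarrow> c \<noteq> b \<longrightarrow> l c = 0)"
    if ab: "a \<noteq> b" "z $ a $ b \<noteq> 0" for a b
  proof -
    have "S = (l a - l b)\<^sup>2 / 2" using term0[of a b] ab by (simp add: off_def)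
    also have "\<dots> = (l a)\<^sup>2 + (l b)\<^sup>2 - (l a + l b)\<^sup>2 / 2" by (simp add: power2_eq_square field_simps)
    finally have "(\<Sum>k\<in>UNIV-{a}-{b}. (l k)\<^sup>2) + (l a + l b)\<^sup>2 / 2 = 0" using S_bound[OF ab(1)] by simp
    then have z: "(\<Sum>k\<in>UNIV-{a}-{b}. (l k)\<^sup>2) = 0" "(l a + l b)\<^sup>2 = 0"
      using sum_nonneg[of "UNIV-{a}-{b}" "\<lambda>k. (l k)\<^sup>2"] zero_le_power2[of "l a + l b"] by (auto simp: add_nonneg_eq_0_iff)
    then have lb: "l b = - l a" and lc: "\<forall>c. c \<noteq> a \<longrightarrow> c \<noteq> b \<longrightarrow> l c = 0"
      by (auto simp: sum_nonneg_eq_0_iff)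
    moreover have "l a \<noteq> 0" using S S_bound[OF ab(1)] z(1) lb by auto
    ultimately show ?thesis by simp
  qed
  have "\<exists>i j. i \<noteq> j \<and> z $ i $ j \<noteq> 0"
  proof (rule ccontr)
    assume "\<not> ?thesis"
    then have "z = t *\<^sub>R x"
      by (auto simp: vec_eq_iff x_nth z_diag zeta)
    then show False using ind by (simp add: lin_indep_iff)
  qed
  then obtain i j where ij: "i \<noteq> j" "z $ i $ j \<noteq> 0" by blast
  note p = pair[OF ij]
  have "{a, b} = {i, j}" if "a \<noteq> b" "z $ a $ b \<noteq> 0" for a b
  proof -
    have "l a \<noteq> 0" "l b \<noteq> 0" using pair[OF that] by auto
    then have "a = i \<or> a = j" "b = i \<or> b = j" using p by blast+
    then show ?thesis using that(1) by auto
  qed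
  then show ?thesis using ij p zeta by blast
qed

end

section \<open>The extremal planes\<close>

lemma hurwitz_subalgebras:
  assumes "K \<in> {Hurw_R, Hurw_C, Hurw_H, Hurw_O}"
  shows "hurwitz_subalgebra K" and "K \<noteq> Hurw_O \<Longrightarrow> assoc_on K"
proof -
  have lin: "linear oct_of_real" "linear oct_of_complex" "linear oct_of_quat"
    by (auto intro!: linearI simp: oct_of_real_def oct_of_complex_def oct_of_quat_def scaleR_conv_of_real)
  have one: "oct_of_real 1 = oct_of_complex 1" "oct_of_real 1 = oct_of_quat (1, 0)"
    by (simp_all add: oct_of_real_def oct_of_complex_def)
  have "hurwitz_subalgebra Hurw_R"
    using linear_subspace_image[OF lin(1) subspace_UNIV]
    by unfold_locales (auto simp: Hurw_R_def oct_of_real_hom simp del: omul_oct_of_real)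
  moreover have "hurwitz_subalgebra Hurw_C"
    using linear_subspace_image[OF lin(2) subspace_UNIV]
    by unfold_locales (auto simp: Hurw_C_def oct_of_complex_hom one)
  moreover have "hurwitz_subalgebra Hurw_H"
    using linear_subspace_image[OF lin(3) subspace_UNIV]
    by unfold_locales (auto simp: Hurw_H_def oct_of_quat_hom one(2))
  moreover have "hurwitz_subalgebra Hurw_O"
    by unfold_locales (auto simp: Hurw_O_def)
  ultimately show "hurwitz_subalgebra K"
    using assms by blast
  have "qmul (qmul a b) c = qmul a (qmul b c)" for a b c
    by (simp add: qmul_def algebra_simps)
  then have H: "assoc_on Hurw_H"
    by (auto simp: assoc_on_def Hurw_H_def oct_of_quat_hom)
  have "Hurw_R \<subseteq> Hurw_H" "Hurw_C \<subseteq> Hurw_H"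
    by (auto simp: Hurw_R_def Hurw_C_def Hurw_H_def oct_of_real_def oct_of_complex_def)
  then show "K \<noteq> Hurw_O \<Longrightarrow> assoc_on K"
    using assms H unfolding assoc_on_def by blast
qed

lemma ex_bij_two_points:
  fixes a b i j :: 'a
  assumes "a \<noteq> b" "i \<noteq> j"
  shows "\<exists>\<sigma>. bij \<sigma> \<and> \<sigma> a = i \<and> \<sigma> b = j"
proof -
  define \<tau> where "\<tau> = Transposition.transpose a i"
  define \<sigma> where "\<sigma> = Transposition.transpose (\<tau> b) j \<circ> \<tau>"
  have "\<tau> b \<noteq> i"
    using assms(1) by (auto simp: \<tau>_def Transposition.transpose_def)
  then have "\<sigma> a = i" "\<sigma> b = j"
    using assms(2) by (simp_all add: \<sigma>_def \<tau>_def Transposition.transpose_def)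
  moreover have "bij \<sigma>" by (simp add: \<sigma>_def \<tau>_def bij_comp)
  ultimately show ?thesis by blast
qed

text \<open>
The standardizing map is composed of a diagonalization of \<open>x\<close>, a phase map that makes the only off-diagonal
entry of the image of \<open>y\<close> real, and a permutation that moves the two indices in use to the first and the
last place. The phase map fixes the image of \<open>x\<close>, since it keeps the diagonal and the norms of all
entries.
\<close>
lemma (in hurwitz_subalgebra) extremal_standard_form:
  fixes x y :: "octonion^('n::{finite,linorder})^('n::{finite,linorder})"
  assumes K: "assoc_on K \<or> CARD('n) = 3" and x: "x \<in> Herm K" and y: "y \<in> Herm K"
    and ind: "lin_indep x y" and eq: "2 * nonassoc_num x y = gram x y"
  shows "\<exists>F \<alpha> \<beta> t. jordan_isometry K F \<and> \<alpha> \<noteq> 0 \<and> \<beta> \<noteq> 0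
    \<and> F x = \<alpha> *\<^sub>R diag_1n \<and> F y = (t * \<alpha>) *\<^sub>R diag_1n + \<beta> *\<^sub>R offdiag_1n"
proof -
  obtain F where F: "jordan_isometry K F" "\<And>i j. i \<noteq> j \<Longrightarrow> F x $ i $ j = 0"
    using diagonalization[OF K x] by blast
  note FH = jordan_isometryD(3)[OF F(1) x] jordan_isometryD(3)[OF F(1) y]
  define l where "l i = oRe (F x $ i $ i)" for i
  define \<zeta> where "\<zeta> i = oRe (F y $ i $ i)" for i
  interpret D: diagonal_pair K "F x" "F y"
    by unfold_locales (use FH F(2) in auto)
  have Dl: "D.l = l" "D.\<zeta> = \<zeta>"
    by (auto simp: fun_eq_iff D.l_def l_def D.\<zeta>_def \<zeta>_def)
  have indF: "lin_indep (F x) (F y)"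
  proof -
    have "F x \<noteq> 0" using ind jordan_isometryD(2)[OF F(1), of x] by (auto simp: lin_indep_iff)
    moreover have "F y \<noteq> c *\<^sub>R F x" for c
    proof
      assume "F y = c *\<^sub>R F x"
      then have "F (y - c *\<^sub>R x) = 0"
        by (simp add: linear_diff linear_scale jordan_isometryD(1)[OF F(1)])
      then have "y = c *\<^sub>R x" using jordan_isometryD(2)[OF F(1), of "y - c *\<^sub>R x"] by simp
      then show False using ind by (simp add: lin_indep_iff)
    qed
    ultimately show ?thesis by (simp add: lin_indep_iff)
  qed
  have "2 * nonassoc_num (F x) (F y) = gram (F x) (F y)"
    using eq by (simp add: jordan_isometry_invariants[OF F(1) x y])
  from D.extremal[OF indF this, unfolded Dl] obtain i j t where ij: "i \<noteq> j" "F y $ i $ j \<noteq> 0"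
    and l: "l i \<noteq> 0" "l j = - l i" "\<And>a. a \<noteq> i \<Longrightarrow> a \<noteq> j \<Longrightarrow> l a = 0" "\<And>a. \<zeta> a = t * l a"
    and off: "\<And>a b. a \<noteq> b \<Longrightarrow> F y $ a $ b \<noteq> 0 \<Longrightarrow> {a, b} = {i, j}"
    by blast
  define q where "q = F y $ i $ j"
  obtain P where P: "jordan_isometry K P" "\<And>w a. w \<in> Herm K \<Longrightarrow> P w $ a $ a = w $ a $ a"
    "\<And>w a b. norm (P w $ a $ b) = norm (w $ a $ b)" "\<And>w. w $ i $ j = q \<Longrightarrow> P w $ i $ j = oct_of_real (norm q)"
    using make_entry_real[OF K ij(1) HermD(1)[OF FH(2), of i j, folded q_def]] by blast
  define x' where "x' = P (F x)"
  define y' where "y' = P (F y)"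
  have y'H: "y' \<in> Herm K" unfolding y'_def by (rule jordan_isometryD(3)[OF P(1) FH(2)])
  define o1 where "o1 = oct_of_real 1"
  have x'_nth: "x' $ a $ b = (if a = b then l a *\<^sub>R o1 else 0)" for a b
  proof (cases "a = b")
    case True
    have "F x $ a $ a = l a *\<^sub>R o1"
      unfolding l_def o1_def by (rule trans[OF HermD(3)[OF FH(1)] oct_of_real_scaleR])
    then show ?thesis using P(2)[OF FH(1), of a] True by (simp add: x'_def)
  next
    case False
    then show ?thesis using P(3)[of "F x" a b] F(2)[OF False] by (simp add: x'_def)
  qed
  have y'_ij: "y' $ i $ j = norm q *\<^sub>R o1"
    unfolding y'_def o1_def using P(4)[of "F y"] by (simp add: q_def flip: oct_of_real_scaleR)
  have o1c: "ocnj o1 = o1" by (simp add: o1_def oct_of_real_hom)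
  have y'_ji: "y' $ j $ i = norm q *\<^sub>R o1"
    using HermD(2)[OF y'H, of i j] by (simp add: y'_ij linear_scale[OF linear_ocnj] o1c)
  have y'_nth: "y' $ a $ b = (if a = b then (t * l a) *\<^sub>R o1 else if {a, b} = {i, j} then norm q *\<^sub>R o1 else 0)" for a b
  proof (cases "a = b")
    case True
    have "F y $ a $ a = \<zeta> a *\<^sub>R o1"
      unfolding \<zeta>_def o1_def by (rule trans[OF HermD(3)[OF FH(2)] oct_of_real_scaleR])
    then show ?thesis using P(2)[OF FH(2), of a] True l(4) by (simp add: y'_def)
  next
    case False
    show ?thesis
    proof (cases "{a, b} = {i, j}")
      case True
      then show ?thesis using False y'_ij y'_ji by (auto simp: doubleton_eq_iff)
    next
      case no: False
      then have "F y $ a $ b = 0" using off[OF False] by blast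
      then show ?thesis using P(3)[of "F y" a b] False no by (simp add: y'_def)
    qed
  qed
  have "Min UNIV \<noteq> (Max UNIV :: 'n)"
  proof
    assume eq: "Min UNIV = (Max UNIV :: 'n)"
    have "a = Max UNIV" for a :: 'n
      using Min_le[of UNIV a] Max_ge[of UNIV a] eq by (simp add: order_antisym)
    then show False using ij(1) by metis
  qed
  then obtain \<sigma> :: "'n \<Rightarrow> 'n" where \<sigma>: "bij \<sigma>" "\<sigma> (Min UNIV) = i" "\<sigma> (Max UNIV) = j"
    using ex_bij_two_points[of "Min UNIV" "Max UNIV" i j] ij(1) by blast
  have inj: "\<sigma> a = \<sigma> b \<longleftrightarrow> a = b" for a b
    using bij_is_inj[OF \<sigma>(1)] by (simp add: inj_eq)
  have inj_i: "\<sigma> a = i \<longleftrightarrow> a = Min UNIV" and inj_j: "\<sigma> a = j \<longleftrightarrow> a = Max UNIV" for a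
    by (simp_all add: inj flip: \<sigma>(2,3))
  have lsig: "l (\<sigma> a) = (if a = Min UNIV then l i else if a = Max UNIV then - l i else 0)" for a
    using \<sigma>(2,3) l(2) l(3)[of "\<sigma> a"] inj_i[of a] inj_j[of a] by auto
  define m where "m = (Min UNIV :: 'n)"
  define M where "M = (Max UNIV :: 'n)"
  have mM: "m \<noteq> M" using \<open>Min UNIV \<noteq> Max UNIV\<close> by (simp add: m_def M_def)
  have D_nth: "diag_1n $ a $ b = (if a = b then (if a = m then o1 else if a = M then - o1 else 0) else 0)" for a b
    using mM by (auto simp: diag_1n_def elem_mat_def o1_def m_def M_def)
  have E_nth: "offdiag_1n $ a $ b = (if {a, b} = {m, M} then o1 else 0)" for a b
    using mM by (auto simp: offdiag_1n_def elem_mat_def o1_def doubleton_eq_iff m_def[symmetric] M_def[symmetric])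
  note sig = inj inj_i[folded m_def] inj_j[folded M_def] lsig[folded m_def M_def]
  have "permute_mat \<sigma> x' = l i *\<^sub>R diag_1n"
    by (auto simp: vec_eq_iff permute_mat_def x'_nth D_nth sig)
  moreover have "permute_mat \<sigma> y' = (t * l i) *\<^sub>R diag_1n + norm q *\<^sub>R offdiag_1n"
  proof -
    have "permute_mat \<sigma> y' $ a $ b = ((t * l i) *\<^sub>R diag_1n + norm q *\<^sub>R offdiag_1n) $ a $ b" for a b
    proof (cases "a = b")
      case True
      then have "{a, b} \<noteq> {m, M}" using mM by auto
      then show ?thesis using True mM by (simp add: permute_mat_def y'_nth D_nth E_nth sig)
    next
      case False
      have "{\<sigma> a, \<sigma> b} = {i, j} \<longleftrightarrow> {a, b} = {m, M}"
        by (simp add: doubleton_eq_iff sig)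
      then show ?thesis using False by (simp add: permute_mat_def y'_nth D_nth E_nth sig)
    qed
    then show ?thesis by (simp add: vec_eq_iff)
  qed
  moreover have "jordan_isometry K (\<lambda>w. permute_mat \<sigma> (P (F w)))"
    by (rule jordan_isometry_compose[OF jordan_isometry_permute[OF \<sigma>(1)] jordan_isometry_compose[OF P(1) F(1)]])
  moreover have "norm q \<noteq> 0" using ij(2) by (simp add: q_def)
  ultimately show ?thesis
    using l(1) unfolding x'_def y'_def by blast
qed

lemma mmul_elem_mat: "mmul (elem_mat i j) (elem_mat k l) = (if j = k then elem_mat i l else 0)"
proof -
  have "(\<Sum>m\<in>UNIV. elem_mat i j $ a $ m \<otimes>\<^sub>O elem_mat k l $ m $ b)
      = (\<Sum>m\<in>UNIV. if m = j then (if j = k then elem_mat i l $ a $ b else 0) else 0)" for a b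
    by (intro sum.cong) (auto simp: elem_mat_def)
  then show ?thesis by (simp add: vec_eq_iff mmul_nth)
qed

lemma inner_elem_mat: "elem_mat i j \<bullet> elem_mat k l = (if i = k \<and> j = l then 1 else 0)"
proof -
  have o: "oct_of_real 1 \<bullet> oct_of_real 1 = 1" by (simp add: dot_square_norm)
  have "(elem_mat i j $ a $ b) \<bullet> (elem_mat k l $ a $ b)
      = (if a = i then (if b = j then (if i = k \<and> j = l then 1 else 0) else 0) else 0)" for a b
    by (auto simp: elem_mat_def o)
  then have "elem_mat i j \<bullet> elem_mat k l
      = (\<Sum>a\<in>UNIV. if a = i then (\<Sum>b\<in>UNIV. if b = j then (if i = k \<and> j = l then 1 else 0) else 0) else 0)"
    unfolding inner_vec_def by (intro sum.cong refl) auto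
  then show ?thesis by simp
qed

text \<open>
The standard pair anticommutes and both matrices have the same square, an idempotent of rank two. Hence the
Jordan product of two elements of the plane is a real multiple of this idempotent, the factor being the
dot product of their coordinates.
\<close>
lemma standard_plane_products:
  fixes d e :: "octonion^('n::{finite,linorder})^('n::{finite,linorder})"
  assumes mM: "Min UNIV \<noteq> (Max UNIV :: 'n)"
  defines "d \<equiv> diag_1n" and "e \<equiv> offdiag_1n"
  shows "d \<star> e = 0" "e \<star> e = d \<star> d" "d \<bullet> d = 2" "e \<bullet> e = 2" "d \<bullet> e = 0" "(d \<star> d) \<bullet> (d \<star> d) = 2"
proof -
  have minus: "mmul (a - b) c = mmul a c - mmul b c" "mmul c (a - b) = mmul c a - mmul c b"
    for a b c :: "octonion^('n::{finite,linorder})^('n::{finite,linorder})"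
    by (simp_all add: vec_eq_iff mmul_nth omul.diff_left omul.diff_right sum_subtractf)
  note simps = d_def e_def diag_1n_def offdiag_1n_def jordan_def minus mmul_add mmul_elem_mat
    mM mM[symmetric] inner_add inner_diff inner_elem_mat
  have dd: "d \<star> d = elem_mat (Min UNIV) (Min UNIV) + elem_mat (Max UNIV) (Max UNIV)"
    by (simp add: simps)
  show "d \<star> e = 0" "e \<star> e = d \<star> d" "d \<bullet> d = 2" "e \<bullet> e = 2" "d \<bullet> e = 0" "(d \<star> d) \<bullet> (d \<star> d) = 2"
    unfolding dd by (simp_all add: simps)
qed

text \<open>
The automorphism is arbitrary here, and its isometry property comes from \<open>hhat_Aut\<close>. In the coordinates of the
standard pair, the numerator and the Gram determinant are \<open>2\<close> and \<open>4\<close> times the same squared determinant.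
\<close>
lemma (in hurwitz_subalgebra) sect_nonassoc_standard:
  fixes x y :: "octonion^('n::{finite,linorder})^('n::{finite,linorder})"
  assumes x: "x \<in> Herm K" and y: "y \<in> Herm K" and ind: "lin_indep x y" and f: "f \<in> Aut_Herm K"
    and fx: "f x = p *\<^sub>R diag_1n + q *\<^sub>R offdiag_1n" and fy: "f y = r *\<^sub>R diag_1n + s *\<^sub>R offdiag_1n"
  shows "sect_nonassoc K x y = real CARD('n) / 2"
proof -
  define n where "n = real CARD('n)"
  have n: "n > 0" by (simp add: n_def)
  have f_mult: "f (a \<star> b) = f a \<star> f b" and fH: "f a \<in> Herm K"
    if "a \<in> Herm K" "b \<in> Herm K" for a b
    using f that by (auto simp: Aut_Herm_def bij_betw_def)
  note H = fH[OF x x] fH[OF y y]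
  have inner: "f a \<bullet> f b = a \<bullet> b" if "a \<in> Herm K" "b \<in> Herm K" for a b
    using hhat_Aut[OF f that] n hhat_inner[OF that] hhat_inner[OF fH[OF that(1) that(1)] fH[OF that(2) that(2)]]
    by (simp add: n_def)
  have num: "nonassoc_num x y = nonassoc_num (f x) (f y)" and gram: "gram x y = gram (f x) (f y)"
    by (simp_all add: nonassoc_num_def gram_def inner x y jordan_Herm flip: f_mult)
  have pos: "0 < gram (f x) (f y)"
    using gram_pos[OF ind] gram by simp
  let ?d = "diag_1n :: ((octonion, 'n) vec, 'n) vec" and ?e = "offdiag_1n :: ((octonion, 'n) vec, 'n) vec"
  \<comment> \<open>for a single index the first standard matrix is zero and the image of the pair is dependent\<close>
  have mM: "Min UNIV \<noteq> (Max UNIV :: 'n)"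
  proof
    assume "Min UNIV = (Max UNIV :: 'n)"
    then have "?d = 0" by (simp add: diag_1n_def)
    then have "gram (f x) (f y) = 0"
      by (simp add: gram_def fx fy power2_eq_square)
    then show False using pos by simp
  qed
  note P = standard_plane_products[OF mM]
  have e_d: "?e \<star> ?d = 0" "?e \<bullet> ?d = 0"
    using P(1,5) by (simp_all add: jordan_commute inner_commute)
  have J: "(a *\<^sub>R ?d + b *\<^sub>R ?e) \<star> (c *\<^sub>R ?d + g *\<^sub>R ?e) = (a * c + b * g) *\<^sub>R (?d \<star> ?d)" for a b c g
    by (simp add: jordan.add_left jordan.add_right jordan.scaleR_left jordan.scaleR_right P(1,2) e_d algebra_simps)
  have I: "(a *\<^sub>R ?d + b *\<^sub>R ?e) \<bullet> (c *\<^sub>R ?d + g *\<^sub>R ?e) = 2 * (a * c + b * g)" for a b c g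
    by (simp add: inner_add P(3-5) e_d)
  have "nonassoc_num (f x) (f y) = 2 * (p * s - q * r)\<^sup>2"
    by (simp add: nonassoc_num_def fx fy J P(6)) (simp add: power2_eq_square algebra_simps)
  moreover have "gram (f x) (f y) = 4 * (p * s - q * r)\<^sup>2"
    by (simp add: gram_def fx fy I) (simp add: power2_eq_square algebra_simps)
  ultimately show ?thesis
    using pos unfolding sect_nonassoc_eq[OF x y] num gram by simp
qed

lemma (in hurwitz_subalgebra) nonassoc_num_bounds:
  fixes x y :: "octonion^'n^'n"
  assumes K: "assoc_on K \<or> CARD('n) = 3" and x: "x \<in> Herm K" and y: "y \<in> Herm K" and nz: "x \<noteq> 0"
  shows "0 \<le> nonassoc_num x y" "2 * nonassoc_num x y \<le> gram x y"
proof -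
  obtain F where F: "jordan_isometry K F" "\<And>i j. i \<noteq> j \<Longrightarrow> F x $ i $ j = 0"
    using diagonalization[OF K x] by blast
  interpret D: diagonal_pair K "F x" "F y"
    by unfold_locales (use jordan_isometryD(3)[OF F(1)] x y F(2) in auto)
  have "F x \<noteq> 0" using nz jordan_isometryD(2)[OF F(1), of x] by auto
  from D.nonassoc_num_bounds[OF this]
  show "0 \<le> nonassoc_num x y" "2 * nonassoc_num x y \<le> gram x y"
    by (simp_all add: jordan_isometry_invariants[OF F(1) x y])
qed

theorem lemma9p14:
  fixes K :: "octonion set"
  assumes "K \<in> {Hurw_R, Hurw_C, Hurw_H, Hurw_O}"
    and "K = Hurw_O \<Longrightarrow> CARD('n::{finite,linorder}) = 3"
  shows
    "(\<forall>x\<in>Herm K. \<forall>y\<in>(Herm K :: (octonion^('n::{finite,linorder})^('n::{finite,linorder})) set).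
        hhat K x y = mat_trace (x \<star> y) / real CARD('n))
   \<and> (\<forall>x\<in>Herm K. \<forall>y\<in>(Herm K :: (octonion^('n::{finite,linorder})^('n::{finite,linorder})) set). lin_indep x y \<longrightarrow>
        0 \<le> sect_nonassoc K x y \<and> sect_nonassoc K x y \<le> real CARD('n) / 2)
   \<and> (assoc_on K \<longrightarrow>
        (\<forall>x\<in>Herm K. \<forall>y\<in>(Herm K :: (octonion^('n::{finite,linorder})^('n::{finite,linorder})) set). lin_indep x y \<longrightarrow>
          (sect_nonassoc K x y = 0 \<longleftrightarrow> mmul x y = mmul y x))
      \<and> (\<forall>x\<in>(Herm K :: (octonion^('n::{finite,linorder})^('n::{finite,linorder})) set). lin_indep x (x \<star> x) \<longrightarrow>
          sect_nonassoc K x (x \<star> x) = 0))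
   \<and> (\<forall>x\<in>Herm K. \<forall>y\<in>(Herm K :: (octonion^('n::{finite,linorder})^('n::{finite,linorder})) set). lin_indep x y \<longrightarrow>
        (simult_equiv_std K x y \<longrightarrow> sect_nonassoc K x y = real CARD('n) / 2)
      \<and> (hhat K x y = 0 \<longrightarrow>
          (sect_nonassoc K x y = real CARD('n) / 2 \<longleftrightarrow> simult_equiv_std K x y))
      \<and> (sect_nonassoc K x y = real CARD('n) / 2 \<longleftrightarrow>
          (\<exists>f\<in>Aut_Herm K. f ` span {x, y} = span {diag_1n, offdiag_1n})))"
proof -
  interpret hurwitz_subalgebra K
    using assms(1) by (rule hurwitz_subalgebras(1))
  have KA: "assoc_on K \<or> CARD('n) = 3"
    using hurwitz_subalgebras(2)[OF assms(1)] assms(2) by blast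
  let ?H = "Herm K :: (((octonion, 'n) vec, 'n) vec) set"
  let ?n = "real CARD('n)"
  let ?std = "\<lambda>x y. \<exists>f\<in>Aut_Herm K. f ` span {x, y} = span {diag_1n, offdiag_1n :: ((octonion, 'n) vec, 'n) vec}"
  have n: "?n > 0" by simp

  have trace: "\<forall>x\<in>?H. \<forall>y\<in>?H. hhat K x y = mat_trace (x \<star> y) / ?n"
    using hhat_trace by blast

  have bounds: "\<forall>x\<in>?H. \<forall>y\<in>?H. lin_indep x y \<longrightarrow> 0 \<le> sect_nonassoc K x y \<and> sect_nonassoc K x y \<le> ?n / 2"
  proof (intro ballI impI)
    fix x y assume x: "x \<in> ?H" and y: "y \<in> ?H" and ind: "lin_indep x y"
    have g: "0 < gram x y" by (rule gram_pos[OF ind])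
    have "x \<noteq> 0" using ind by (simp add: lin_indep_iff)
    note b = nonassoc_num_bounds[OF KA x y this]
    have "?n * (2 * nonassoc_num x y) \<le> ?n * gram x y"
      using b(2) n by (intro mult_left_mono) auto
    then have "?n * nonassoc_num x y / gram x y \<le> ?n / 2"
      using g by (simp add: divide_le_eq)
    then show "0 \<le> sect_nonassoc K x y \<and> sect_nonassoc K x y \<le> ?n / 2"
      unfolding sect_nonassoc_eq[OF x y] using b(1) g by simp
  qed

  have lower: "sect_nonassoc K x y = 0 \<longleftrightarrow> mmul x y = mmul y x"
    if A: "assoc_on K" and x: "x \<in> ?H" and y: "y \<in> ?H" and ind: "lin_indep x y" for x y
    using gram_pos[OF ind] by (simp add: sect_nonassoc_eq[OF x y] nonassoc_num_commutator[OF A x y])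

  have square: "sect_nonassoc K x (x \<star> x) = 0"
    if A: "assoc_on K" and x: "x \<in> ?H" and ind: "lin_indep x (x \<star> x)" for x
  proof -
    have sq: "x \<star> x = mmul x x" by (simp add: jordan_def)
    have "mmul x (mmul x x) = mmul (mmul x x) x"
      using mmul_assoc[OF A, of x x x] HermD(1)[OF x] by simp
    then show ?thesis
      using lower[OF A x jordan_Herm[OF x x] ind] by (simp add: sq)
  qed

  have upper: "(simult_equiv_std K x y \<longrightarrow> sect_nonassoc K x y = ?n / 2)
      \<and> (hhat K x y = 0 \<longrightarrow> (sect_nonassoc K x y = ?n / 2 \<longleftrightarrow> simult_equiv_std K x y))
      \<and> (sect_nonassoc K x y = ?n / 2 \<longleftrightarrow> ?std x y)"
    if x: "x \<in> ?H" and y: "y \<in> ?H" and ind: "lin_indep x y" for x y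
  proof -
    have from_pair: "sect_nonassoc K x y = ?n / 2" if pair: "simult_equiv_std K x y"
    proof -
      obtain f a b where "f \<in> Aut_Herm K" "f x = a *\<^sub>R diag_1n" "f y = b *\<^sub>R offdiag_1n"
        using pair unfolding simult_equiv_std_def by blast
      then show ?thesis
        using sect_nonassoc_standard[OF x y ind, of f a 0 0 b] by simp
    qed
    have from_plane: "sect_nonassoc K x y = ?n / 2" if plane: "?std x y"
    proof -
      obtain f where f: "f \<in> Aut_Herm K" and im: "f ` span {x, y} = span {diag_1n, offdiag_1n}"
        using plane by blast
      have "f x \<in> span {diag_1n, offdiag_1n}" "f y \<in> span {diag_1n, offdiag_1n}"
        unfolding im[symmetric] by (auto intro: imageI span_base)
      then obtain p q r s where "f x = p *\<^sub>R diag_1n + q *\<^sub>R offdiag_1n" "f y = r *\<^sub>R diag_1n + s *\<^sub>R offdiag_1n"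
        by (auto simp: span_insert span_singleton algebra_simps)
      then show ?thesis
        by (rule sect_nonassoc_standard[OF x y ind f])
    qed
    have std: "?std x y \<and> (hhat K x y = 0 \<longrightarrow> simult_equiv_std K x y)" if "sect_nonassoc K x y = ?n / 2"
    proof -
      have "2 * nonassoc_num x y = gram x y"
        using that gram_pos[OF ind] n unfolding sect_nonassoc_eq[OF x y] by (simp add: field_simps)
      then obtain F \<alpha> \<beta> t where F: "jordan_isometry K F" and nz: "\<alpha> \<noteq> 0" "\<beta> \<noteq> 0"
        and Fx: "F x = \<alpha> *\<^sub>R diag_1n" and Fy: "F y = (t * \<alpha>) *\<^sub>R diag_1n + \<beta> *\<^sub>R offdiag_1n"
        using extremal_standard_form[OF KA x y ind] by blast
      let ?d = "diag_1n :: ((octonion, 'n) vec, 'n) vec" and ?e = "offdiag_1n :: ((octonion, 'n) vec, 'n) vec"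
      have "F ` span {x, y} = span {F x, F y}"
        using linear_span_image[OF jordan_isometryD(1)[OF F], of "{x, y}"] by simp
      also have "\<dots> = span {?d, ?e}"
      proof (intro subset_antisym span_minimal subspace_span subsetI)
        fix w assume "w \<in> {F x, F y}"
        then show "w \<in> span {?d, ?e}"
          by (auto simp: Fx Fy intro!: span_add span_scale intro: span_base)
      next
        fix w assume w: "w \<in> {?d, ?e}"
        have "?d = (1 / \<alpha>) *\<^sub>R F x" using nz by (simp add: Fx)
        moreover have "?e = (1 / \<beta>) *\<^sub>R (F y - t *\<^sub>R F x)" using nz by (simp add: Fx Fy)
        moreover have "(1 / \<alpha>) *\<^sub>R F x \<in> span {F x, F y}" "(1 / \<beta>) *\<^sub>R (F y - t *\<^sub>R F x) \<in> span {F x, F y}"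
          by (intro span_scale span_diff span_base; simp)+
        ultimately show "w \<in> span {F x, F y}" using w by (metis insertE singletonD)
      qed
      finally have "?std x y" using jordan_isometry_Aut[OF F] by blast
      moreover have "simult_equiv_std K x y" if "hhat K x y = 0"
      proof -
        have "Min UNIV \<noteq> (Max UNIV :: 'n)"
        proof
          assume "Min UNIV = (Max UNIV :: 'n)"
          then have "F x = 0" by (simp add: Fx diag_1n_def)
          then show False
            using ind jordan_isometryD(2)[OF F, of x] by (simp add: lin_indep_iff)
        qed
        note P = standard_plane_products[OF this]
        have "F x \<bullet> F y = 0"
          using that n by (simp add: hhat_inner[OF x y] jordan_isometryD(5)[OF F])
        then have "t = 0" using nz by (simp add: Fx Fy inner_add_right P(3,5))
        then show ?thesis
          using jordan_isometry_Aut[OF F] Fx Fy unfolding simult_equiv_std_def by auto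
      qed
      ultimately show ?thesis by blast
    qed
    show ?thesis using from_pair from_plane std by blast
  qed
  show ?thesis
  proof (rule conjI[OF trace conjI[OF bounds conjI]], goal_cases)
    case 1
    show ?case using lower square by simp
  next
    case 2
    show ?case by (intro ballI impI upper)
  qed
qed

end
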